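(* Consider the primal problem (P) and its dual (D) given in the context, and assume that the optimal solution set $\mathcal{T}_\phi^{-1}(0)$ of (P) is non-empty. Let $\{(z^k,X^k)\}$, $z^k=(y^k,w^k,S^k)$, be an infinite sequence generated by the augmented Lagrangian method (ALM) described in the context with stopping criterion $(A')$. Then the whole sequence $\{X^k\}$ is bounded and converges to some $X^\infty\in\mathcal{T}_\phi^{-1}(0)$, and for all $k\ge 0$, $z^{k+1}\in\mathbb{D}$, $$\|\mathcal{A}^*y^{k+1}+\mathcal{F}^*w^{k+1}+S^{k+1}-C\|=c_k^{-1}\|X^{k+1}-X^k\|\to 0,$$ $$\vartheta(z^{k+1})-\inf\vartheta\le \zeta_k(z^{k+1})-\inf\zeta_k+\frac{1}{2c_k}\left(\|X^k\|^2-\|X^{k+1}\|^2\right).$$ Moreover, if problem (D) admits a non-empty and bounded solution set, then $\{z^k\}$ is also bounded and all of its accumulation points are optimal solutions to (D). Regarding convergence rates: (a) If $\mathcal{T}_\phi$ is metrically subregular at $X^\infty$ for the origin with modulus $\kappa_\phi>0$, and criterion $(B')$ is also employed, then there exists $\bar k\ge 0$ such that for all $k\ge\bar k$, $\eta_k<1$ and $$\mathrm{dist}(X^{k+1},\mathcal{T}_\phi^{-1}(0))\le\theta_k\,\mathrm{dist}(X^k,\mathcal{T}_\phi^{-1}(0)),$$ $$\|\mathcal{A}^*y^{k+1}+\mathcal{F}^*w^{k+1}+S^{k+1}-C\|\le\tau_k\,\mathrm{dist}(X^k,\mathcal{T}_\phi^{-1}(0)),$$ $$\vartheta(z^{k+1})-\inf\vartheta\le\tau_k'\,\mathrm{dist}(X^k,\mathcal{T}_\phi^{-1}(0)),$$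 where $$1>\theta_k=\left(\kappa_\phi/\sqrt{\kappa_\phi^2+c_k^2}+2\eta_k\right)(1-\eta_k)^{-1}\to\theta_\infty=\kappa_\phi/\sqrt{\kappa_\phi^2+c_\infty^2}\quad(\theta_\infty=0\text{ if }c_\infty=\infty),$$ $$\tau_k=c_k^{-1}(1-\eta_k)^{-1}\to\tau_\infty=1/c_\infty\quad(\tau_\infty=0\text{ if }c_\infty=\infty),$$ $$\tau_k'=\tau_k\left(\eta_k^2\|X^{k+1}-X^k\|+\|X^{k+1}\|+\|X^k\|\right)/2\to\tau_\infty'=\|X^\infty\|/c_\infty\quad(\tau'_\infty=0\text{ if }c_\infty=\infty).$$ (b) Suppose that, in addition to $(B')$ and the metric subregularity of $\mathcal{T}_\phi$ at $X^\infty$ for the origin, criterion $(B'')$ is employed, $\mathcal{T}_\psi^{-1}(0)$ is non-empty and bounded, and there exist constants $\kappa_l\ge 0$ and $\epsilon>0$ such that for any $(z,X)\in\mathbb{Z}\times\mathbb{S}^n$ satisfying $\mathrm{dist}((z,X),\mathcal{T}_\psi^{-1}(0)\times\{X^\infty\})\le\epsilon$, $$\mathrm{dist}((z,X),\mathcal{T}_l^{-1}(0))\le\kappa_l\,\mathrm{dist}(0,\mathcal{T}_l(z,X)).$$ Then there exists $\tilde k\ge 0$ such that for all $k\ge\tilde k$, $\eta_k<1$ and $$\mathrm{dist}(z^{k+1},\mathcal{T}_\psi^{-1}(0))\le\theta_k'\,\mathrm{dist}(X^k,\mathcal{T}_\phi^{-1}(0)),$$ where $\theta_k'=\kappa_l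 c_k^{-1}(1+\eta_k')(1-\eta_k)^{-1}\to\theta_\infty'=\kappa_l/c_\infty$ ($\theta_\infty'=0$ if $c_\infty=\infty$).
   Context: $\mathbb{S}^n$ is the space of $n\times n$ real symmetric matrices with the trace inner product and Frobenius norm; $\mathbb{S}^n_+$ is the cone of positive semidefinite matrices. $\mathbb{Y},\mathbb{W}$ are finite dimensional real Euclidean spaces; $\mathcal{F}:\mathbb{S}^n\to\mathbb{W}$ and $\mathcal{A}:\mathbb{S}^n\to\mathbb{Y}$ are linear maps with adjoints $\mathcal{F}^*,\mathcal{A}^*$; $\mathcal{Q}\subseteq\mathbb{Y}$ is a convex polyhedral cone with polar $\mathcal{Q}^\circ=\{v:\langle v,q\rangle\le 0\ \forall q\in\mathcal{Q}\}$; $C\in\mathbb{S}^n$, $b\in\mathbb{Y}$. The function $h:\mathbb{W}\to(-\infty,+\infty]$ is continuously differentiable on $\mathrm{dom}(h)$, which is a non-empty open convex set, and is strictly convex on any convex subset of $\mathrm{dom}(h)$; $h^*$ is its conjugate. Primal problem (P): $\max\{-h(\mathcal{F}X)-\langle C,X\rangle : b-\mathcal{A}X\in\mathcal{Q}^\circ,\ X\in\mathbb{S}^n_+\}$ (equivalently, minimize $h(\mathcal{F}X)+\langle C,X\rangle$ over the same set). Dual problem (D): with $\mathbb{Z}=\mathbb{Y}\times\mathbb{W}\times\mathbb{S}^n$, $\mathbb{D}=\mathcal{Q}\times\mathbb{W}\times\mathbb{S}^n_+$, $z=(y,w,S)$, $$\min\{\vartheta(z):=-\langle b,y\rangle+h^*(-w)\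 :\ \mathcal{A}^*y+\mathcal{F}^*w+S=C,\ z\in\mathbb{D}\};$$ $\inf\vartheta$ denotes the optimal value of (D). Lagrangian: $l(z,X)=-\langle b,y\rangle+h^*(-w)+\langle X,\mathcal{A}^*y+\mathcal{F}^*w+S-C\rangle$ for $z\in\mathbb{D}$, $X\in\mathbb{S}^n$ (and $l=+\infty$ for $z\notin\mathbb{D}$). $\psi(z)=\sup_X l(z,X)$ (convex), $\phi(X)=\inf_z l(z,X)$ (concave). $\mathcal{T}_l(z,X)=\{(u,v)\in\mathbb{Z}\times\mathbb{S}^n:(u,-v)\in\partial l(z,X)\}$ ($\partial l$ being the convex-concave subdifferential), $\mathcal{T}_\psi=\partial\psi$, $\mathcal{T}_\phi=-\partial\phi$ (i.e. the convex subdifferential of $-\phi$). $\mathcal{T}_\phi^{-1}(0)$ is the optimal solution set of (P), $\mathcal{T}_\psi^{-1}(0)$ that of (D). Metric subregularity: a multi-valued mapping $F$ is metrically subregular at $\bar x$ for $\bar y$ with modulus $\kappa\ge 0$ if $\bar y\in F(\bar x)$ and there is a neighborhood $\mathcal{U}$ of $\bar x$ such that $\mathrm{dist}(x,F^{-1}(\bar y))\le\kappa\,\mathrm{dist}(\bar y,F(x))$ for all $x\in\mathcal{U}$. ALM: let $0<c_k\uparrow c_\infty\le\infty$ and $X^0\in\mathbb{S}^n_+$. Let $L_c(z,X)=l(z,X)+\frac{c}{2}\|\mathcal{A}^*y+\mathcal{F}^*w+S-C\|^2$, $\zeta_k(z)=L_{c_k}(z,X^k)$ for $z\in\mathbb{D}$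 ($+\infty$ otherwise), $\inf\zeta_k=\inf_{z\in\mathbb{D}}\zeta_k(z)$, and $\mathcal{S}_k(y,w)=\Pi_{\mathbb{S}^n_+}(C-\mathcal{A}^*y-\mathcal{F}^*w-c_k^{-1}X^k)$, where $\Pi$ is the metric projection. For $k\ge 0$: $(y^{k+1},w^{k+1})$ is an approximate minimizer of $\zeta_k(y,w,\mathcal{S}_k(y,w))$ over $y\in\mathcal{Q}$, $w\in\mathbb{W}$; $S^{k+1}=\mathcal{S}_k(y^{k+1},w^{k+1})$; $X^{k+1}=X^k+c_k(\mathcal{A}^*y^{k+1}+\mathcal{F}^*w^{k+1}+S^{k+1}-C)=\Pi_{\mathbb{S}^n_+}(X^k+c_k(\mathcal{A}^*y^{k+1}+\mathcal{F}^*w^{k+1}-C))$. The stopping criteria (required for every $k\ge 0$) are: $(A')$ $\zeta_k(z^{k+1})-\inf\zeta_k\le\varepsilon_k^2/(2c_k)$, with $\varepsilon_k\ge 0$, $\sum_{k=0}^\infty\varepsilon_k<\infty$; $(B')$ $\zeta_k(z^{k+1})-\inf\zeta_k\le(\eta_k^2/(2c_k))\|X^{k+1}-X^k\|^2$, with $\eta_k\ge 0$, $\sum_{k=0}^\infty\eta_k<\infty$; $(B'')$ $\mathrm{dist}(0,\partial\zeta_k(z^{k+1}))\le(\eta_k'/c_k)\|X^{k+1}-X^k\|$, with $0\le\eta_k'\to 0$. *)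

theory Defs
  imports "HOL-Analysis.Analysis"
begin

typedef (overloaded) 'n::finite symmat = "{M :: real^'n^'n. transpose M = M}"
  morphisms mat_of Abs_symmat
  by (rule exI[of _ 0]) (simp add: transpose_def vec_eq_iff)

setup_lifting type_definition_symmat

lemma mat_of_sym: "mat_of X $ i $ j = mat_of X $ j $ i"
proof -
  have "transpose (mat_of X) $ j $ i = mat_of X $ j $ i"
    using mat_of[of X] by simp
  then show ?thesis by (simp add: transpose_def)
qed

instantiation symmat :: (finite) real_inner
begin

lift_definition zero_symmat :: "'a symmat" is 0
  by (simp add: transpose_def vec_eq_iff)
lift_definition plus_symmat :: "'a symmat \<Rightarrow> 'a symmat \<Rightarrow> 'a symmat" is "(+)"
  by (simp add: transpose_def vec_eq_iff)
lift_definition minus_symmat :: "'a symmat \<Rightarrow> 'a symmat \<Rightarrow> 'a symmat" is "(-)"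
  by (simp add: transpose_def vec_eq_iff)
lift_definition uminus_symmat :: "'a symmat \<Rightarrow> 'a symmat" is uminus
  by (simp add: transpose_def vec_eq_iff)
lift_definition scaleR_symmat :: "real \<Rightarrow> 'a symmat \<Rightarrow> 'a symmat" is "(*\<^sub>R)"
  by (simp add: transpose_def vec_eq_iff)

definition inner_symmat :: "'a symmat \<Rightarrow> 'a symmat \<Rightarrow> real" where
  "inner_symmat X Y = trace (mat_of X ** mat_of Y)"
definition norm_symmat :: "'a symmat \<Rightarrow> real" where
  "norm_symmat X = sqrt (inner X X)"
definition dist_symmat :: "'a symmat \<Rightarrow> 'a symmat \<Rightarrow> real" where
  "dist_symmat X Y = norm (X - Y)"
definition sgn_symmat :: "'a symmat \<Rightarrow> 'a symmat" where
  "sgn_symmat X = scaleR (inverse (norm X)) X"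
definition uniformity_symmat :: "('a symmat \<times> 'a symmat) filter" where
  "uniformity_symmat = (INF e\<in>{0 <..}. principal {(x, y). dist x y < e})"
definition open_symmat :: "'a symmat set \<Rightarrow> bool" where
  "open_symmat U \<longleftrightarrow> (\<forall>x\<in>U. eventually (\<lambda>(x', y). x' = x \<longrightarrow> y \<in> U) uniformity)"

lemma inner_mat_of: "inner X Y = inner (mat_of X) (mat_of (Y :: 'a symmat))"
  unfolding inner_symmat_def trace_def matrix_matrix_mult_def inner_vec_def
  by (simp, intro sum.cong refl, subst mat_of_sym, simp)

instance
proof
  fix X Y Z :: "'a symmat" and r s :: real and U :: "'a symmat set"
  show "X + Y + Z = X + (Y + Z)" "X + Y = Y + X" "0 + X = X" "- X + X = 0" "X - Y = X + - Y"
    "r *\<^sub>R (X + Y) = r *\<^sub>R X + r *\<^sub>R Y" "(r + s) *\<^sub>R X = r *\<^sub>R X + s *\<^sub>R X"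
    "r *\<^sub>R s *\<^sub>R X = (r * s) *\<^sub>R X" "1 *\<^sub>R X = X"
    by (simp_all add: mat_of_inject[symmetric] zero_symmat.rep_eq plus_symmat.rep_eq
        minus_symmat.rep_eq uminus_symmat.rep_eq scaleR_symmat.rep_eq algebra_simps)
  show "dist X Y = norm (X - Y)" by (rule dist_symmat_def)
  show "sgn X = scaleR (inverse (norm X)) X" by (rule sgn_symmat_def)
  show "uniformity = (INF e\<in>{0 <..}. principal {(x :: 'a symmat, y). dist x y < e})"
    by (rule uniformity_symmat_def)
  show "open U \<longleftrightarrow> (\<forall>x\<in>U. eventually (\<lambda>(x', y). x' = x \<longrightarrow> y \<in> U) uniformity)"
    by (rule open_symmat_def)
  show "inner X Y = inner Y X" "inner (X + Y) Z = inner X Z + inner Y Z"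
    "inner (r *\<^sub>R X) Y = r * inner X Y" "0 \<le> inner X X"
    by (simp_all add: inner_mat_of plus_symmat.rep_eq scaleR_symmat.rep_eq inner_add_left)
      (rule inner_commute)
  show "inner X X = 0 \<longleftrightarrow> X = 0"
    by (simp add: inner_mat_of mat_of_inject[symmetric] zero_symmat.rep_eq)
  show "norm X = sqrt (inner X X)" by (rule norm_symmat_def)
qed

end

lemma linear_mat_of: "linear mat_of"
  by (rule linearI) (simp_all add: plus_symmat.rep_eq scaleR_symmat.rep_eq)

lemma subspace_symmetric: "subspace {M :: real^'n^'n. transpose M = M}"
  by (auto simp: subspace_def transpose_def vec_eq_iff)

lemma symmat_orthonormal_basis:
  "\<exists>B :: 'a::finite symmat set. finite B \<and> B \<noteq> {} \<and>
     (\<forall>u\<in>B. \<forall>v\<in>B. inner u v = (if u = v then 1 else 0)) \<and>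
     (\<forall>x. (\<forall>u\<in>B. inner x u = 0) \<longleftrightarrow> x = 0)"
proof -
  let ?S = "{M :: real^'a^'a. transpose M = M}"
  obtain B where B: "B \<subseteq> ?S" "pairwise orthogonal B" "\<And>x. x \<in> B \<Longrightarrow> norm x = 1"
      "independent B" "card B = dim ?S" "span B = ?S"
    using orthonormal_basis_subspace[OF subspace_symmetric] by blast
  define C where "C = Abs_symmat ` B"
  have im: "mat_of ` C = B"
    unfolding C_def image_image using B(1)
    by (subst image_cong[OF refl, where g = "\<lambda>x. x"]) (auto simp: Abs_symmat_inverse)
  have fin: "finite C"
    unfolding C_def using B(4) independent_imp_finite by blast
  have orth: "inner u v = (if u = v then 1 else 0)" if "u \<in> C" "v \<in> C" for u v
  proof -
    have uv: "mat_of u \<in> B" "mat_of v \<in> B" using that im by auto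
    show ?thesis
    proof (cases "u = v")
      case True
      then show ?thesis using B(3)[OF uv(1)] by (simp add: inner_mat_of norm_eq_1)
    next
      case False
      then have "mat_of u \<noteq> mat_of v" by (simp add: mat_of_inject)
      with B(2) uv have "orthogonal (mat_of u) (mat_of v)" unfolding pairwise_def by blast
      with False show ?thesis by (simp add: inner_mat_of orthogonal_def)
    qed
  qed
  have zero: "x = 0" if "\<forall>u\<in>C. inner x u = 0" for x
  proof -
    have "\<And>m. m \<in> B \<Longrightarrow> orthogonal (mat_of x) m"
      using that by (auto simp: im[symmetric] orthogonal_def inner_mat_of)
    moreover have "mat_of x \<in> span B" using B(6) mat_of[of x] by simp
    ultimately have "orthogonal (mat_of x) (mat_of x)"
      by (rule orthogonal_to_span[rotated])
    then have "inner x x = 0" unfolding inner_mat_of orthogonal_def .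
    then show ?thesis by simp
  qed
  have ne: "C \<noteq> {}"
  proof
    assume "C = {}"
    then have "Abs_symmat (mat 1) = (0 :: 'a symmat)" by (intro zero) simp
    then have "mat_of (Abs_symmat (mat 1)) = (0 :: real^'a^'a)" by (simp add: zero_symmat.rep_eq)
    then have "mat 1 = (0 :: real^'a^'a)" by (simp add: Abs_symmat_inverse)
    then show False by (auto simp: mat_def vec_eq_iff split: if_splits)
  qed
  show ?thesis
  proof (intro exI[of _ C] conjI ballI allI iffI)
    show "finite C" "C \<noteq> {}" by (fact fin, fact ne)
    show "\<And>u v. u \<in> C \<Longrightarrow> v \<in> C \<Longrightarrow> inner u v = (if u = v then 1 else 0)" by (fact orth)
    show "\<And>x. \<forall>u\<in>C. inner x u = 0 \<Longrightarrow> x = 0" by (fact zero)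
    show "\<And>x u. x = 0 \<Longrightarrow> u \<in> C \<Longrightarrow> inner x u = 0" by simp
  qed
qed

instantiation symmat :: (finite) euclidean_space
begin

text \<open>The type class wants some orthonormal basis; nothing below depends on which one it is.\<close>
definition Basis_symmat :: "'a symmat set" where
  "Basis_symmat = (SOME B. finite B \<and> B \<noteq> {} \<and>
     (\<forall>u\<in>B. \<forall>v\<in>B. inner u v = (if u = v then 1 else 0)) \<and>
     (\<forall>x. (\<forall>u\<in>B. inner x u = 0) \<longleftrightarrow> x = 0))"

instance
proof
  note B = someI_ex[OF symmat_orthonormal_basis[where 'a = 'a], folded Basis_symmat_def]
  show "(Basis :: 'a symmat set) \<noteq> {}" by (rule B[THEN conjunct2, THEN conjunct1])
  show "finite (Basis :: 'a symmat set)" by (rule B[THEN conjunct1])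
  show "inner u v = (if u = v then 1 else 0)" if "u \<in> Basis" "v \<in> Basis" for u v :: "'a symmat"
    by (rule B[THEN conjunct2, THEN conjunct2, THEN conjunct1, THEN bspec, THEN bspec,
          OF that(1) that(2)])
  show "(\<forall>u\<in>Basis. inner x u = 0) \<longleftrightarrow> x = 0" for x :: "'a symmat"
    by (rule B[THEN conjunct2, THEN conjunct2, THEN conjunct2, THEN spec])
qed

end

definition psd_cone :: "'n::finite symmat set" where
  "psd_cone = {X. \<forall>v. 0 \<le> v \<bullet> (mat_of X *v v)}"

lemma psd_matrix_inner_nonneg:
  fixes M N :: "real^'n^'n"
  assumes "transpose M = M" "\<And>v. 0 \<le> v \<bullet> (M *v v)" "\<And>v. 0 \<le> v \<bullet> (N *v v)"
  shows "0 \<le> M \<bullet> N"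
  using assms
proof (induction "card {i. M $ i \<noteq> 0}" arbitrary: M rule: less_induct)
  case less
  note psd = less.prems(2)
  have sym: "M $ i $ j = M $ j $ i" for i j
    using less.prems(1) by (metis transpose_def vec_lambda_beta)
  have bil: "x \<bullet> (M *v y) = y \<bullet> (M *v x)" for x y
    using less.prems(1) by (metis dot_lmul_matrix inner_commute transpose_matrix_vector)
  have ax: "axis i 1 \<bullet> (M *v y) = M $ i \<bullet> y" for i y
    by (simp add: inner_axis' matrix_vector_mul_component)
  show ?case
  proof (cases "M = 0")
    case True then show ?thesis by simp
  next
    case False
    then obtain i where i: "M $ i \<noteq> 0" by (auto simp: vec_eq_iff)
    let ?d = "M $ i $ i" and ?u = "M $ i"
    have Mij: "axis i 1 \<bullet> (M *v axis j 1) = M $ i $ j" for i j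
      by (simp add: ax inner_axis)
    have d0: "0 \<le> ?d" using psd[of "axis i 1"] by (simp only: Mij)
    have "?d \<noteq> 0"
    proof
      assume d: "?d = 0"
      obtain j where j: "M $ i $ j \<noteq> 0" using i by (auto simp: vec_eq_iff)
      define t where "t = - (M $ j $ j + 1) / (2 * M $ i $ j)"
      have "0 \<le> (t *\<^sub>R axis i 1 + axis j 1) \<bullet> (M *v (t *\<^sub>R axis i 1 + axis j 1))" by (rule psd)
      also have "\<dots> = t\<^sup>2 * ?d + 2 * t * M $ i $ j + M $ j $ j"
        by (simp add: matrix_vector_right_distrib matrix_vector_mult_scaleR inner_add_left
            inner_add_right Mij sym[of j i] power2_eq_square algebra_simps)
      also have "\<dots> = -1" using d j by (simp add: t_def field_simps)
      finally show False by simp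
    qed
    with d0 have dpos: "0 < ?d" by simp
    define R :: "real^'n^'n" where "R = (\<chi> j k. ?u $ j * ?u $ k)"
    define M' where "M' = M - (1 / ?d) *\<^sub>R R"
    have Rv: "R *v v = (?u \<bullet> v) *\<^sub>R ?u" for v
      by (simp add: R_def matrix_vector_mult_def vec_eq_iff inner_vec_def sum_distrib_left
          sum_distrib_right mult_ac)
    have M'v: "M' *v v = M *v v - ((?u \<bullet> v) / ?d) *\<^sub>R ?u" for v
      by (simp add: M'_def matrix_vector_mult_diff_rdistrib scaleR_matrix_vector_assoc[symmetric] Rv)
    have "0 \<le> v \<bullet> (M' *v v)" for v
    proof -
      define a where "a = (?u \<bullet> v) / ?d"
      have "0 \<le> (v - a *\<^sub>R axis i 1) \<bullet> (M *v (v - a *\<^sub>R axis i 1))" by (rule psd)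
      also have "\<dots> = v \<bullet> (M *v v) - 2 * a * (?u \<bullet> v) + a\<^sup>2 * ?d"
        by (simp add: matrix_vector_mult_diff_distrib matrix_vector_mult_scaleR inner_diff_left
            inner_diff_right Mij ax inner_axis bil[of v "axis i 1"] power2_eq_square algebra_simps)
      also have "\<dots> = v \<bullet> (M' *v v)"
        using dpos by (simp add: M'v a_def inner_diff_right inner_commute power2_eq_square field_simps)
      finally show ?thesis .
    qed
    moreover have "transpose M' = M'"
      by (simp add: M'_def R_def transpose_def vec_eq_iff sym mult.commute)
    moreover have "card {j. M' $ j \<noteq> 0} < card {j. M $ j \<noteq> 0}"
    proof (rule psubset_card_mono)
      have "M' $ i = 0" using dpos by (simp add: M'_def R_def vec_eq_iff)
      moreover have "M' $ j = 0" if "M $ j = 0" for j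
        using that sym[of i j] by (simp add: M'_def R_def vec_eq_iff)
      ultimately show "{j. M' $ j \<noteq> 0} \<subset> {j. M $ j \<noteq> 0}" using i by blast
    qed simp
    ultimately have "0 \<le> M' \<bullet> N" using less.hyps less.prems(3) by blast
    moreover have "R \<bullet> N = ?u \<bullet> (N *v ?u)"
      by (simp add: R_def inner_vec_def matrix_vector_mult_def sum_distrib_left mult_ac)
    moreover have "M \<bullet> N = M' \<bullet> N + (1 / ?d) * (R \<bullet> N)"
      by (simp add: M'_def inner_diff_left)
    ultimately show ?thesis using dpos less.prems(3)[of ?u] by simp
  qed
qed

lemma psd_cone_inner_nonneg: "X \<in> psd_cone \<Longrightarrow> S \<in> psd_cone \<Longrightarrow> 0 \<le> X \<bullet> S"
  unfolding inner_mat_of psd_cone_def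
  by (rule psd_matrix_inner_nonneg) (use mat_of[of X] in auto)

lemma psd_cone_self_dual:
  fixes X :: "'n::finite symmat"
  assumes "\<And>S. S \<in> psd_cone \<Longrightarrow> 0 \<le> X \<bullet> S"
  shows "X \<in> psd_cone"
proof -
  have "0 \<le> v \<bullet> (mat_of X *v v)" for v
  proof -
    define R :: "real^'n^'n" where "R = (\<chi> j k. v $ j * v $ k)"
    have R: "mat_of (Abs_symmat R) = R"
      by (rule Abs_symmat_inverse) (simp add: R_def transpose_def vec_eq_iff mult.commute)
    have Ru: "R *v u = (v \<bullet> u) *\<^sub>R v" for u
      by (simp add: R_def matrix_vector_mult_def vec_eq_iff inner_vec_def sum_distrib_left
          sum_distrib_right mult_ac)
    have "Abs_symmat R \<in> psd_cone"
      by (simp add: psd_cone_def R Ru inner_commute)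
    from assms[OF this] have "0 \<le> mat_of X \<bullet> R" by (simp add: inner_mat_of R)
    also have "\<dots> = v \<bullet> (mat_of X *v v)"
      by (simp add: R_def inner_vec_def matrix_vector_mult_def sum_distrib_left mult_ac)
    finally show ?thesis .
  qed
  then show ?thesis by (simp add: psd_cone_def)
qed

text \<open>Distance to a set, with value \<open>\<infinity>\<close> for the empty set (\<^const>\<open>infdist\<close> would return 0).\<close>
definition set_dist :: "'a::metric_space \<Rightarrow> 'a set \<Rightarrow> ereal" where
  "set_dist x S = (INF y\<in>S. ereal (dist x y))"

definition polar_cone :: "'a::real_inner set \<Rightarrow> 'a set" where
  "polar_cone K = {v. \<forall>q\<in>K. v \<bullet> q \<le> 0}"

definition edom :: "('a \<Rightarrow> ereal) \<Rightarrow> 'a set" where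
  "edom f = {x. f x < \<infinity>}"

definition conjugate :: "('a::real_inner \<Rightarrow> ereal) \<Rightarrow> 'a \<Rightarrow> ereal" where
  "conjugate f w = (SUP x. ereal (w \<bullet> x) - f x)"

definition subdiff :: "('a::real_inner \<Rightarrow> ereal) \<Rightarrow> 'a \<Rightarrow> 'a set" where
  "subdiff f x = {v. \<bar>f x\<bar> \<noteq> \<infinity> \<and> (\<forall>y. f x + ereal (v \<bullet> (y - x)) \<le> f y)}"

text \<open>\<open>K\<close> is convex in its first and concave in its second argument.\<close>
definition saddle_subdiff ::
  "('a::real_inner \<Rightarrow> 'b::real_inner \<Rightarrow> ereal) \<Rightarrow> 'a \<times> 'b \<Rightarrow> ('a \<times> 'b) set" where
  "saddle_subdiff K = (\<lambda>(z, X). {(u, v). u \<in> subdiff (\<lambda>z'. K z' X) z \<and>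
     \<bar>K z X\<bar> \<noteq> \<infinity> \<and> (\<forall>X'. K z X' \<le> K z X + ereal (v \<bullet> (X' - X)))})"

definition strictly_convex_on :: "'a::real_vector set \<Rightarrow> ('a \<Rightarrow> real) \<Rightarrow> bool" where
  "strictly_convex_on S f \<longleftrightarrow> (\<forall>x\<in>S. \<forall>y\<in>S. \<forall>t. x \<noteq> y \<and> 0 < t \<and> t < 1 \<longrightarrow>
     f ((1 - t) *\<^sub>R x + t *\<^sub>R y) < (1 - t) * f x + t * f y)"

definition continuously_differentiable_on :: "'a::real_inner set \<Rightarrow> ('a \<Rightarrow> real) \<Rightarrow> bool" where
  "continuously_differentiable_on S f \<longleftrightarrow> (\<exists>g. continuous_on S g \<and>
     (\<forall>x\<in>S. (f has_derivative (\<lambda>d. g x \<bullet> d)) (at x)))"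

definition mv_inverse :: "('a \<Rightarrow> 'b set) \<Rightarrow> 'b \<Rightarrow> 'a set" where
  "mv_inverse F y = {x. y \<in> F x}"

text \<open>Where \<open>F x\<close> is empty the inequality reads \<open>\<dots> \<le> \<kappa> * \<infinity>\<close> and is void. The guard is there
  because \<^typ>\<open>ereal\<close> has \<open>0 * \<infinity> = 0\<close>.\<close>
definition metrically_subregular ::
  "('a::metric_space \<Rightarrow> 'b::metric_space set) \<Rightarrow> 'a \<Rightarrow> 'b \<Rightarrow> real \<Rightarrow> bool" where
  "metrically_subregular F x0 y0 \<kappa> \<longleftrightarrow> 0 \<le> \<kappa> \<and> y0 \<in> F x0 \<and>
     (\<exists>U. open U \<and> x0 \<in> U \<and> (\<forall>x\<in>U. F x \<noteq> {} \<longrightarrow>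
        set_dist x (mv_inverse F y0) \<le> ereal \<kappa> * set_dist y0 (F x)))"

record ('n, 'y, 'w) sdp =
  Fmap :: "'n::finite symmat \<Rightarrow> 'w::euclidean_space"
  Amap :: "'n symmat \<Rightarrow> 'y::euclidean_space"
  Qset :: "'y set"
  hfun :: "'w \<Rightarrow> ereal"
  bvec :: 'y
  Cmat :: "'n symmat"

definition sdp_data :: "('n::finite, 'y::euclidean_space, 'w::euclidean_space) sdp \<Rightarrow> bool" where
  "sdp_data P \<longleftrightarrow> linear (Fmap P) \<and> linear (Amap P) \<and>
     polyhedron (Qset P) \<and> convex_cone (Qset P) \<and>
     (\<forall>x. hfun P x \<noteq> -\<infinity>) \<and>
     edom (hfun P) \<noteq> {} \<and> open (edom (hfun P)) \<and> convex (edom (hfun P)) \<and>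
     continuously_differentiable_on (edom (hfun P)) (\<lambda>x. real_of_ereal (hfun P x)) \<and>
     (\<forall>K\<subseteq>edom (hfun P). convex K \<longrightarrow> strictly_convex_on K (\<lambda>x. real_of_ereal (hfun P x)))"

definition primal_feasible ::
  "('n::finite, 'y::euclidean_space, 'w::euclidean_space) sdp \<Rightarrow> 'n symmat set" where
  "primal_feasible P = {X. bvec P - Amap P X \<in> polar_cone (Qset P) \<and> X \<in> psd_cone}"

definition primal_obj ::
  "('n::finite, 'y::euclidean_space, 'w::euclidean_space) sdp \<Rightarrow> 'n symmat \<Rightarrow> ereal" where
  "primal_obj P X = - hfun P (Fmap P X) - ereal (Cmat P \<bullet> X)"

definition primal_solutions ::
  "('n::finite, 'y::euclidean_space, 'w::euclidean_space) sdp \<Rightarrow> 'n symmat set" where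
  "primal_solutions P = {X \<in> primal_feasible P. primal_obj P X \<noteq> -\<infinity> \<and>
     (\<forall>X'\<in>primal_feasible P. primal_obj P X' \<le> primal_obj P X)}"

definition dual_dom ::
  "('n::finite, 'y::euclidean_space, 'w::euclidean_space) sdp \<Rightarrow> ('y \<times> 'w \<times> 'n symmat) set" where
  "dual_dom P = Qset P \<times> UNIV \<times> psd_cone"

definition dual_res ::
  "('n::finite, 'y::euclidean_space, 'w::euclidean_space) sdp \<Rightarrow> 'y \<times> 'w \<times> 'n symmat \<Rightarrow> 'n symmat" where
  "dual_res P = (\<lambda>(y, w, S). adjoint (Amap P) y + adjoint (Fmap P) w + S - Cmat P)"

definition dual_obj ::
  "('n::finite, 'y::euclidean_space, 'w::euclidean_space) sdp \<Rightarrow> 'y \<times> 'w \<times> 'n symmat \<Rightarrow> ereal" where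
  "dual_obj P = (\<lambda>(y, w, S). ereal (- (bvec P \<bullet> y)) + conjugate (hfun P) (- w))"

definition dual_feasible ::
  "('n::finite, 'y::euclidean_space, 'w::euclidean_space) sdp \<Rightarrow> ('y \<times> 'w \<times> 'n symmat) set" where
  "dual_feasible P = {z \<in> dual_dom P. dual_res P z = 0}"

definition dual_value ::
  "('n::finite, 'y::euclidean_space, 'w::euclidean_space) sdp \<Rightarrow> ereal" where
  "dual_value P = (INF z\<in>dual_feasible P. dual_obj P z)"

definition dual_solutions ::
  "('n::finite, 'y::euclidean_space, 'w::euclidean_space) sdp \<Rightarrow> ('y \<times> 'w \<times> 'n symmat) set" where
  "dual_solutions P = {z \<in> dual_feasible P. dual_obj P z \<noteq> \<infinity> \<and>
     (\<forall>z'\<in>dual_feasible P. dual_obj P z \<le> dual_obj P z')}"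

definition lagr :: "('n::finite, 'y::euclidean_space, 'w::euclidean_space) sdp \<Rightarrow>
    'y \<times> 'w \<times> 'n symmat \<Rightarrow> 'n symmat \<Rightarrow> ereal" where
  "lagr P z X = (if z \<in> dual_dom P then dual_obj P z + ereal (X \<bullet> dual_res P z) else \<infinity>)"

definition psi :: "('n::finite, 'y::euclidean_space, 'w::euclidean_space) sdp \<Rightarrow>
    'y \<times> 'w \<times> 'n symmat \<Rightarrow> ereal" where
  "psi P z = (SUP X. lagr P z X)"

definition phi ::
  "('n::finite, 'y::euclidean_space, 'w::euclidean_space) sdp \<Rightarrow> 'n symmat \<Rightarrow> ereal" where
  "phi P X = (INF z. lagr P z X)"

definition T_l :: "('n::finite, 'y::euclidean_space, 'w::euclidean_space) sdp \<Rightarrow>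
    ('y \<times> 'w \<times> 'n symmat) \<times> 'n symmat \<Rightarrow> (('y \<times> 'w \<times> 'n symmat) \<times> 'n symmat) set" where
  "T_l P p = {(u, v). (u, - v) \<in> saddle_subdiff (lagr P) p}"

definition T_psi :: "('n::finite, 'y::euclidean_space, 'w::euclidean_space) sdp \<Rightarrow>
    'y \<times> 'w \<times> 'n symmat \<Rightarrow> ('y \<times> 'w \<times> 'n symmat) set" where
  "T_psi P = subdiff (psi P)"

definition T_phi :: "('n::finite, 'y::euclidean_space, 'w::euclidean_space) sdp \<Rightarrow>
    'n symmat \<Rightarrow> 'n symmat set" where
  "T_phi P = subdiff (\<lambda>X. - phi P X)"

lemma conjugate_not_MInf:
  assumes "sdp_data P"
  shows "conjugate (hfun P) w \<noteq> -\<infinity>"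
proof -
  obtain x where x: "hfun P x < \<infinity>" using assms by (auto simp: sdp_data_def edom_def)
  then obtain r where r: "hfun P x = ereal r"
    using assms by (cases "hfun P x") (auto simp: sdp_data_def)
  have "ereal (w \<bullet> x) - hfun P x \<le> conjugate (hfun P) w"
    unfolding conjugate_def by (rule SUP_upper) simp
  then show ?thesis by (auto simp: r)
qed

lemma lagr_expand:
  assumes "sdp_data P" "(y, w, S) \<in> dual_dom P"
  shows "lagr P (y, w, S) X = conjugate (hfun P) (- w) +
    ereal (- ((bvec P - Amap P X) \<bullet> y) + Fmap P X \<bullet> w + X \<bullet> S - Cmat P \<bullet> X)"
proof -
  have lin: "linear (Amap P)" "linear (Fmap P)" using assms(1) by (auto simp: sdp_data_def)
  show ?thesis
    using assms(2) conjugate_not_MInf[OF assms(1), of "- w"]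
    by (cases "conjugate (hfun P) (- w)")
      (auto simp: lagr_def dual_obj_def dual_res_def inner_add_right inner_diff_right
        inner_diff_left adjoint_works[OF lin(1)] adjoint_works[OF lin(2)] inner_commute)
qed

lemma dual_obj_not_MInf: "sdp_data P \<Longrightarrow> dual_obj P z \<noteq> -\<infinity>"
  using conjugate_not_MInf[of P "- fst (snd z)"]
  by (cases z; cases "conjugate (hfun P) (- fst (snd z))") (auto simp: dual_obj_def)

lemma psi_eq:
  assumes "sdp_data P"
  shows "psi P z = (if z \<in> dual_feasible P then dual_obj P z else \<infinity>)"
proof (cases "z \<in> dual_feasible P")
  case True
  then show ?thesis by (simp add: psi_def lagr_def dual_feasible_def flip: zero_ereal_def)
next
  case False
  have "psi P z = \<infinity>"
  proof (cases "z \<in> dual_dom P \<and> dual_obj P z \<noteq> \<infinity>")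
    case True
    then obtain r where r: "dual_obj P z = ereal r"
      using dual_obj_not_MInf[OF assms] by (cases "dual_obj P z") auto
    have nz: "dual_res P z \<noteq> 0" using True False by (auto simp: dual_feasible_def)
    show ?thesis
    proof (rule ereal_top)
      fix B :: real
      let ?X = "((B - r) / (dual_res P z \<bullet> dual_res P z)) *\<^sub>R dual_res P z"
      have "ereal B = lagr P z ?X" using True r nz by (simp add: lagr_def)
      also have "\<dots> \<le> psi P z" unfolding psi_def by (rule SUP_upper) simp
      finally show "ereal B \<le> psi P z" .
    qed
  next
    case False
    then have "lagr P z 0 = \<infinity>" by (auto simp: lagr_def)
    then show ?thesis unfolding psi_def
      by (metis SUP_upper UNIV_I ereal_infty_less_eq(1))
  qed
  with False show ?thesis by simp
qed

lemma mv_inverse_T_psi: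
  assumes "sdp_data P"
  shows "mv_inverse (T_psi P) 0 = dual_solutions P"
proof -
  have "z \<in> mv_inverse (T_psi P) 0 \<longleftrightarrow> z \<in> dual_solutions P" for z
    using dual_obj_not_MInf[OF assms, of z]
    by (auto simp: mv_inverse_def T_psi_def subdiff_def psi_eq[OF assms] dual_solutions_def
        simp flip: zero_ereal_def split: if_splits)
  then show ?thesis by blast
qed

lemma phi_concave:
  assumes "sdp_data P" "ereal r \<le> phi P X" "ereal s \<le> phi P Y" "0 \<le> t" "t \<le> 1"
  shows "ereal ((1 - t) * r + t * s) \<le> phi P ((1 - t) *\<^sub>R X + t *\<^sub>R Y)"
  unfolding phi_def
proof (rule INF_greatest)
  fix z
  have X: "ereal r \<le> lagr P z X" and Y: "ereal s \<le> lagr P z Y"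
    using assms(2,3) INF_lower[of z UNIV] unfolding phi_def by (meson UNIV_I order_trans)+
  show "ereal ((1 - t) * r + t * s) \<le> lagr P z ((1 - t) *\<^sub>R X + t *\<^sub>R Y)"
  proof (cases "z \<in> dual_dom P \<and> dual_obj P z \<noteq> \<infinity>")
    case True
    then obtain d where d: "dual_obj P z = ereal d"
      using dual_obj_not_MInf[OF assms(1)] by (cases "dual_obj P z") auto
    have "(1 - t) * r + t * s \<le> (1 - t) * (d + X \<bullet> dual_res P z) + t * (d + Y \<bullet> dual_res P z)"
      using X Y True d assms(4,5)
      by (intro add_mono mult_left_mono) (auto simp: lagr_def)
    then show ?thesis using True d by (simp add: lagr_def inner_add_left algebra_simps)
  qed (auto simp: lagr_def)
qed

lemma hfun_ereal:
  assumes "sdp_data P" "x \<in> edom (hfun P)"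
  shows "hfun P x = ereal (real_of_ereal (hfun P x))"
  using assms by (cases "hfun P x") (auto simp: sdp_data_def edom_def)

lemma hfun_tangent:
  assumes P: "sdp_data P" and x: "x \<in> edom (hfun P)" and y: "y \<in> edom (hfun P)"
    and g: "((\<lambda>x. real_of_ereal (hfun P x)) has_derivative (\<lambda>d. g \<bullet> d)) (at x)"
  shows "real_of_ereal (hfun P x) + g \<bullet> (y - x) \<le> real_of_ereal (hfun P y)"
proof -
  let ?D = "edom (hfun P)" and ?H = "\<lambda>x. real_of_ereal (hfun P x)"
  have op: "open ?D" and cv: "convex ?D" and sc: "strictly_convex_on ?D ?H"
    using P by (auto simp: sdp_data_def)
  have Hc: "convex_on ?D ?H"
  proof (rule convex_onI[OF _ cv])
    fix t :: real and a b assume *: "0 < t" "t < 1" "a \<in> ?D" "b \<in> ?D"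
    show "?H ((1 - t) *\<^sub>R a + t *\<^sub>R b) \<le> (1 - t) * ?H a + t * ?H b"
    proof (cases "a = b")
      case True then show ?thesis by (simp add: algebra_simps flip: scaleR_add_left)
    next
      case False then show ?thesis using sc * unfolding strictly_convex_on_def by (simp add: less_imp_le)
    qed
  qed
  define l where "l t = x + t *\<^sub>R (y - x)" for t :: real
  define A where "A = l -` ?D"
  have cont: "continuous_on UNIV l" unfolding l_def by (intro continuous_intros)
  have openA: "open A" unfolding A_def using op cont by (simp add: open_vimage)
  have aff: "l ((1 - t) * a + t * b) = (1 - t) *\<^sub>R l a + t *\<^sub>R l b" for t a b
    by (simp add: l_def algebra_simps)
  have cA: "convex A"
    unfolding convex_alt A_def using cv by (auto simp: aff convex_alt)
  have "convex_on A (?H \<circ> l)"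
    by (rule convex_onI[OF _ cA]) (use convex_onD[OF Hc] in \<open>auto simp: aff A_def\<close>)
  moreover have "0 \<in> interior A" "1 \<in> A"
    using openA x y by (auto simp: interior_open A_def l_def)
  moreover have "((?H \<circ> l) has_field_derivative (g \<bullet> (y - x))) (at 0 within A)"
  proof -
    have "(l has_derivative (\<lambda>t. t *\<^sub>R (y - x))) (at 0)"
      unfolding l_def by (auto intro!: derivative_eq_intros)
    moreover have "(?H has_derivative (\<lambda>d. g \<bullet> d)) (at (l 0))" using g by (simp add: l_def)
    ultimately have "((?H \<circ> l) has_derivative ((\<lambda>d. g \<bullet> d) \<circ> (\<lambda>t. t *\<^sub>R (y - x)))) (at 0)"
      by (rule diff_chain_at)
    then have "((?H \<circ> l) has_field_derivative (g \<bullet> (y - x))) (at 0)"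
      unfolding has_field_derivative_def by (simp add: o_def mult.commute[of _ "g \<bullet> (y - x)"])
    then show ?thesis by (rule has_field_derivative_at_within)
  qed
  ultimately have "(g \<bullet> (y - x)) * (1 - 0) \<le> (?H \<circ> l) 1 - (?H \<circ> l) 0"
    using convex_on_imp_above_tangent[of A] convex_connected[OF cA] by blast
  then show ?thesis by (simp add: l_def)
qed

lemma conjugate_gradient:
  assumes P: "sdp_data P" and x: "x \<in> edom (hfun P)"
  obtains g where "conjugate (hfun P) g \<le> ereal (g \<bullet> x - real_of_ereal (hfun P x))"
proof -
  obtain g where g: "((\<lambda>x. real_of_ereal (hfun P x)) has_derivative (\<lambda>d. g \<bullet> d)) (at x)"
    using P x unfolding sdp_data_def continuously_differentiable_on_def by blast
  have "ereal (g \<bullet> y) - hfun P y \<le> ereal (g \<bullet> x - real_of_ereal (hfun P x))" for y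
  proof (cases "y \<in> edom (hfun P)")
    case True
    from hfun_tangent[OF P x True g] show ?thesis
      by (subst hfun_ereal[OF P True]) (simp add: inner_diff_right)
  next
    case False
    then show ?thesis by (simp add: edom_def)
  qed
  then show ?thesis using that unfolding conjugate_def by (blast intro: SUP_least)
qed

lemma primal_obj_le_phi:
  fixes P :: "('n::finite, 'y::euclidean_space, 'w::euclidean_space) sdp"
  assumes P: "sdp_data P" and X: "X \<in> primal_feasible P"
  shows "primal_obj P X \<le> phi P X"
  unfolding phi_def
proof (rule INF_greatest)
  fix z :: "'y \<times> 'w \<times> 'n symmat"
  obtain y w S where z: "z = (y, w, S)" by (cases z)
  show "primal_obj P X \<le> lagr P z X"
  proof (cases "z \<in> dual_dom P \<and> Fmap P X \<in> edom (hfun P)")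
    case True
    obtain r where h: "hfun P (Fmap P X) = ereal r" using hfun_ereal[OF P] True by blast
    have y: "(bvec P - Amap P X) \<bullet> y \<le> 0" and S: "0 \<le> X \<bullet> S"
      using True X by (auto simp: z primal_feasible_def dual_dom_def polar_cone_def
          intro: psd_cone_inner_nonneg)
    have "primal_obj P X = ereal (- r - Cmat P \<bullet> X)" by (simp add: primal_obj_def h)
    also have "\<dots> \<le> ereal (- w \<bullet> Fmap P X - r)
        + ereal (- ((bvec P - Amap P X) \<bullet> y) + Fmap P X \<bullet> w + X \<bullet> S - Cmat P \<bullet> X)"
      using y S by (simp add: inner_commute)
    also have "ereal (- w \<bullet> Fmap P X - r) = ereal (- w \<bullet> Fmap P X) - hfun P (Fmap P X)"
      by (simp add: h)
    also have "\<dots> \<le> conjugate (hfun P) (- w)"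
      unfolding conjugate_def by (rule SUP_upper) simp
    finally show ?thesis using True by (simp add: z lagr_expand[OF P] add_right_mono)
  next
    case False
    then show ?thesis by (auto simp: primal_obj_def lagr_def edom_def)
  qed
qed

lemma phi_eq_primal_obj:
  assumes P: "sdp_data P" and X: "X \<in> primal_feasible P" and FX: "Fmap P X \<in> edom (hfun P)"
  shows "phi P X = primal_obj P X"
proof (rule antisym[OF _ primal_obj_le_phi[OF P X]])
  obtain r where r: "hfun P (Fmap P X) = ereal r" using hfun_ereal[OF P FX] by blast
  then obtain g where g: "conjugate (hfun P) g \<le> ereal (g \<bullet> Fmap P X - r)"
    using conjugate_gradient[OF P FX] by (metis real_of_ereal.simps(1))
  have "0 \<in> Qset P" using P by (auto simp: sdp_data_def convex_cone_contains_0)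
  then have dom: "(0, - g, 0) \<in> dual_dom P"
    by (simp add: dual_dom_def psd_cone_def zero_symmat.rep_eq)
  have "phi P X \<le> lagr P (0, - g, 0) X" unfolding phi_def by (rule INF_lower) simp
  also have "\<dots> = conjugate (hfun P) g + ereal (- (Fmap P X \<bullet> g) - Cmat P \<bullet> X)"
    by (simp add: lagr_expand[OF P dom])
  also have "\<dots> \<le> ereal (g \<bullet> Fmap P X - r)
      + ereal (- (Fmap P X \<bullet> g) - Cmat P \<bullet> X)"
    using g by (rule add_right_mono)
  also have "\<dots> = primal_obj P X"
    by (simp add: primal_obj_def r inner_commute)
  finally show "phi P X \<le> primal_obj P X" .
qed

lemma phi_infeasible:
  fixes P :: "('n::finite, 'y::euclidean_space, 'w::euclidean_space) sdp"
  assumes P: "sdp_data P" and X: "X \<notin> primal_feasible P"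
  shows "phi P X = -\<infinity>"
proof -
  obtain x where "x \<in> edom (hfun P)" using P by (auto simp: sdp_data_def)
  then obtain g r where g: "conjugate (hfun P) g \<le> ereal r" using conjugate_gradient[OF P] by metis
  have 0: "0 \<in> Qset P" "(0 :: 'n symmat) \<in> psd_cone"
    using P by (auto simp: sdp_data_def convex_cone_contains_0 psd_cone_def zero_symmat.rep_eq)
  have Qs: "t *\<^sub>R q \<in> Qset P" if "q \<in> Qset P" "0 \<le> t" for q t
    using P that by (auto simp: sdp_data_def convex_cone_def conic_def)
  have Ss: "t *\<^sub>R S \<in> psd_cone" if "S \<in> psd_cone" "0 \<le> t" for S :: "'n symmat" and t
    using that by (auto simp: psd_cone_def scaleR_symmat.rep_eq simp flip: scaleR_matrix_vector_assoc)
  have "\<exists>y S. y \<in> Qset P \<and> S \<in> psd_cone \<and> - ((bvec P - Amap P X) \<bullet> y) + X \<bullet> S < 0"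
  proof (cases "X \<in> psd_cone")
    case True
    then obtain q where "q \<in> Qset P" "0 < (bvec P - Amap P X) \<bullet> q"
      using X by (auto simp: primal_feasible_def polar_cone_def not_le)
    then show ?thesis using 0 by (intro exI[of _ q] exI[of _ 0]) auto
  next
    case False
    then obtain S where "S \<in> psd_cone" "X \<bullet> S < 0" using psd_cone_self_dual[of X] by (meson not_le)
    then show ?thesis using 0 by (intro exI[of _ 0] exI[of _ S]) auto
  qed
  then obtain y S where yS: "y \<in> Qset P" "S \<in> psd_cone"
    and neg: "- ((bvec P - Amap P X) \<bullet> y) + X \<bullet> S < 0" by blast
  let ?m = "- ((bvec P - Amap P X) \<bullet> y) + X \<bullet> S"
  let ?k = "r - Fmap P X \<bullet> g - Cmat P \<bullet> X"
  show ?thesis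
  proof (rule ereal_bot)
    fix B :: real
    define t where "t = max 0 ((B - ?k) / ?m)"
    have t: "0 \<le> t" "?k + t * ?m \<le> B"
    proof -
      have "t * ?m \<le> ((B - ?k) / ?m) * ?m"
        using neg unfolding t_def by (intro mult_right_mono_neg) auto
      then show "?k + t * ?m \<le> B" using neg by simp
    qed (simp add: t_def)
    have dom: "(t *\<^sub>R y, - g, t *\<^sub>R S) \<in> dual_dom P"
      using Qs[OF yS(1) t(1)] Ss[OF yS(2) t(1)] by (simp add: dual_dom_def)
    have "phi P X \<le> lagr P (t *\<^sub>R y, - g, t *\<^sub>R S) X" unfolding phi_def by (rule INF_lower) simp
    also have "\<dots> = conjugate (hfun P) g + ereal (- (Fmap P X \<bullet> g) - Cmat P \<bullet> X + t * ?m)"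
      by (simp add: lagr_expand[OF P dom] algebra_simps)
    also have "\<dots> \<le> ereal r + ereal (- (Fmap P X \<bullet> g) - Cmat P \<bullet> X + t * ?m)"
      using g by (rule add_right_mono)
    also have "\<dots> \<le> ereal B" using t(2) by simp
    finally show "phi P X \<le> ereal B" .
  qed
qed

text \<open>The proviso is needed because \<open>hfun\<close> is not required to be lower semicontinuous: \<open>phi\<close> only
  sees its closure, whose optimum may be attained outside the open domain of \<open>hfun\<close>.\<close>
lemma mv_inverse_T_phi:
  assumes P: "sdp_data P" and ne: "primal_solutions P \<noteq> {}"
  shows "mv_inverse (T_phi P) 0 = primal_solutions P"
proof -
  obtain X0 where X0: "X0 \<in> primal_feasible P" "primal_obj P X0 \<noteq> -\<infinity>"
    and opt: "\<And>X. X \<in> primal_feasible P \<Longrightarrow> primal_obj P X \<le> primal_obj P X0"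
    using ne by (auto simp: primal_solutions_def)
  let ?D = "edom (hfun P)" and ?H = "\<lambda>x. real_of_ereal (hfun P x)"
  have inD: "Fmap P X \<in> ?D \<longleftrightarrow> primal_obj P X \<noteq> -\<infinity>" for X
    using P by (cases "hfun P (Fmap P X)") (auto simp: primal_obj_def edom_def sdp_data_def)
  have obj: "primal_obj P X = ereal (- ?H (Fmap P X) - Cmat P \<bullet> X)" if "Fmap P X \<in> ?D" for X
    unfolding primal_obj_def by (subst hfun_ereal[OF P that]) simp
  define m where "m = - ?H (Fmap P X0) - Cmat P \<bullet> X0"
  have D0: "Fmap P X0 \<in> ?D" using X0 inD by blast
  then have m: "primal_obj P X0 = ereal m" "phi P X0 = ereal m"
    using obj phi_eq_primal_obj[OF P X0(1)] by (simp_all add: m_def)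
  have lin: "linear (Fmap P)" "linear (Amap P)" and op: "open ?D" and cv: "convex ?D"
    and sc: "strictly_convex_on ?D ?H"
    using P by (auto simp: sdp_data_def)
  have feas: "X \<in> primal_feasible P" if "phi P X \<noteq> -\<infinity>" for X
    using phi_infeasible[OF P, of X] that by blast
  have seg: "\<exists>t. 0 < t \<and> t < 1 \<and> Fmap P ((1 - t) *\<^sub>R X0 + t *\<^sub>R X) \<in> ?D" for X
  proof -
    define l where "l t = (1 - t) *\<^sub>R Fmap P X0 + t *\<^sub>R Fmap P X" for t :: real
    have "open (l -` ?D)"
      by (rule open_vimage[OF op]) (unfold l_def, intro continuous_intros)
    moreover have "0 \<in> l -` ?D" using D0 by (simp add: l_def)
    ultimately obtain e where e: "0 < e" "\<And>t. \<bar>t\<bar> < e \<Longrightarrow> l t \<in> ?D"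
      unfolding open_real by force
    have "l (min (e/2) (1/2)) \<in> ?D" using e(1) by (intro e(2)) auto
    then show ?thesis using e(1)
      by (intro exI[of _ "min (e/2) (1/2)"])
        (auto simp: l_def linear_add[OF lin(1)] linear_scale[OF lin(1)])
  qed
  have phi_le: "phi P X \<le> ereal m" for X
  proof (rule ccontr)
    assume "\<not> phi P X \<le> ereal m"
    then have "ereal m < phi P X" by simp
    then obtain s where "ereal m < ereal s" "ereal s < phi P X" using ereal_dense2 by blast
    then have s: "m < s" "ereal s \<le> phi P X" by simp_all
    obtain t where t: "0 < t" "t < 1" and D: "Fmap P ((1 - t) *\<^sub>R X0 + t *\<^sub>R X) \<in> ?D"
      using seg by blast
    let ?Y = "(1 - t) *\<^sub>R X0 + t *\<^sub>R X"
    have Y: "ereal ((1 - t) * m + t * s) \<le> phi P ?Y"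
      using phi_concave[OF P _ s(2), of m X0 t] m t by simp
    then have "?Y \<in> primal_feasible P" by (intro feas) auto
    then have "phi P ?Y \<le> ereal m" using phi_eq_primal_obj[OF P _ D] opt m(1) by simp
    with Y have "ereal ((1 - t) * m + t * s) \<le> ereal m" by (rule order_trans)
    then have "t * (s - m) \<le> 0" by (simp add: algebra_simps)
    moreover have "0 < t * (s - m)" using s(1) t(1) by simp
    ultimately show False by linarith
  qed
  have zeros: "X \<in> mv_inverse (T_phi P) 0 \<longleftrightarrow> phi P X = ereal m" for X
  proof -
    have "X \<in> mv_inverse (T_phi P) 0 \<longleftrightarrow> \<bar>phi P X\<bar> \<noteq> \<infinity> \<and> (\<forall>Y. phi P Y \<le> phi P X)"
      unfolding mv_inverse_def T_phi_def subdiff_def mem_Collect_eq inner_zero_left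
        zero_ereal_def[symmetric] add_0_right ereal_minus_le_minus abs_ereal_uminus ..
    also have "\<dots> \<longleftrightarrow> phi P X = ereal m"
    proof
      assume "\<bar>phi P X\<bar> \<noteq> \<infinity> \<and> (\<forall>Y. phi P Y \<le> phi P X)"
      then have "ereal m \<le> phi P X" using m(2) by metis
      then show "phi P X = ereal m" using phi_le by (simp add: antisym)
    qed (simp add: phi_le)
    finally show ?thesis .
  qed
  have "X \<in> primal_solutions P" if X: "phi P X = ereal m" for X
  proof -
    have fX: "X \<in> primal_feasible P" using X by (intro feas) auto
    have DX: "Fmap P X \<in> ?D"
    proof (rule ccontr)
      assume nD: "Fmap P X \<notin> ?D"
      obtain t where t: "0 < t" "t < 1" and D: "Fmap P ((1 - t) *\<^sub>R X0 + t *\<^sub>R X) \<in> ?D"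
        using seg by blast
      let ?Y = "(1 - t) *\<^sub>R X0 + t *\<^sub>R X"
      have top: "phi P Z = ereal m" if "Z = (1 - a) *\<^sub>R X0 + a *\<^sub>R X" "0 \<le> a" "a \<le> 1" for a Z
      proof (rule antisym[OF phi_le])
        have "(1 - a) * m + a * m = m" by (simp add: left_diff_distrib)
        then show "ereal m \<le> phi P Z"
          using phi_concave[OF P, of m X0 m X a] that(2,3) m(2) X unfolding that(1) by simp
      qed
      have Y: "phi P ?Y = ereal m" using top t by auto
      have FY: "Fmap P ?Y = (1 - t) *\<^sub>R Fmap P X0 + t *\<^sub>R Fmap P X"
        by (simp add: linear_add[OF lin(1)] linear_scale[OF lin(1)])
      have neq: "Fmap P X0 \<noteq> Fmap P ?Y"
      proof
        assume "Fmap P X0 = Fmap P ?Y"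
        then have "Fmap P X0 = (1 - t) *\<^sub>R Fmap P X0 + t *\<^sub>R Fmap P X" unfolding FY .
        then have "t *\<^sub>R Fmap P X = t *\<^sub>R Fmap P X0" by (simp add: scaleR_left_diff_distrib)
        then show False using t nD D0 by simp
      qed
      let ?Z = "(1 - 1/2) *\<^sub>R X0 + (1/2 :: real) *\<^sub>R ?Y"
      have FZ: "Fmap P ?Z = (1 - 1/2) *\<^sub>R Fmap P X0 + (1/2 :: real) *\<^sub>R Fmap P ?Y"
        unfolding linear_add[OF lin(1), of "(1 - 1/2) *\<^sub>R X0"] linear_scale[OF lin(1), of _ X0]
          linear_scale[OF lin(1), of _ ?Y] ..
      have "?Z = (1 - t/2) *\<^sub>R X0 + (t/2) *\<^sub>R X"
        by (rule euclidean_eqI) (simp add: inner_add_left inner_diff_left field_simps)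
      then have Z: "phi P ?Z = ereal m" using t by (intro top) auto
      have DZ: "Fmap P ?Z \<in> ?D"
        unfolding FZ by (rule convexD_alt[OF cv D0 D]) simp_all
      have "?H (Fmap P ?Z) < (1 - 1/2) * ?H (Fmap P X0) + 1/2 * ?H (Fmap P ?Y)"
        unfolding FZ by (rule sc[unfolded strictly_convex_on_def, rule_format, OF D0 D])
          (use neq in simp)
      moreover have "- ?H (Fmap P ?Y) - Cmat P \<bullet> ?Y = m"
        using phi_eq_primal_obj[OF P feas D] Y obj[OF D] by simp
      moreover have "- ?H (Fmap P ?Z) - Cmat P \<bullet> ?Z = m"
        using phi_eq_primal_obj[OF P feas DZ] Z obj[OF DZ] by simp
      moreover have "Cmat P \<bullet> ?Z = (1 - 1/2) * (Cmat P \<bullet> X0) + 1/2 * (Cmat P \<bullet> ?Y)"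
        by (simp only: inner_add_right inner_scaleR_right)
      ultimately show False unfolding m_def by simp
    qed
    have "primal_obj P X = ereal m" using phi_eq_primal_obj[OF P fX DX] X by simp
    then show ?thesis using fX opt m(1) by (simp add: primal_solutions_def)
  qed
  moreover have "phi P X = ereal m" if X: "X \<in> primal_solutions P" for X
  proof -
    have "primal_obj P X = ereal m"
      using X X0(1) opt[of X] m(1) by (auto simp: primal_solutions_def intro: antisym)
    then show ?thesis
      using X phi_eq_primal_obj[OF P] inD[of X] by (auto simp: primal_solutions_def)
  qed
  ultimately show ?thesis using zeros by blast
qed

definition aug_lagr :: "('n::finite, 'y::euclidean_space, 'w::euclidean_space) sdp \<Rightarrow> real \<Rightarrow>
    'y \<times> 'w \<times> 'n symmat \<Rightarrow> 'n symmat \<Rightarrow> ereal" where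
  "aug_lagr P c z X = lagr P z X + ereal (c / 2 * (norm (dual_res P z))\<^sup>2)"

definition S_update :: "('n::finite, 'y::euclidean_space, 'w::euclidean_space) sdp \<Rightarrow> real \<Rightarrow>
    'n symmat \<Rightarrow> 'y \<Rightarrow> 'w \<Rightarrow> 'n symmat" where
  "S_update P c X y w = closest_point psd_cone
     (Cmat P - adjoint (Amap P) y - adjoint (Fmap P) w - (1 / c) *\<^sub>R X)"

text \<open>Already \<open>\<infinity>\<close> off \<^const>\<open>dual_dom\<close>, because \<^const>\<open>lagr\<close> is.\<close>
definition zeta :: "('n::finite, 'y::euclidean_space, 'w::euclidean_space) sdp \<Rightarrow> real \<Rightarrow>
    'n symmat \<Rightarrow> 'y \<times> 'w \<times> 'n symmat \<Rightarrow> ereal" where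
  "zeta P c X z = aug_lagr P c z X"

definition zeta_gap :: "('n::finite, 'y::euclidean_space, 'w::euclidean_space) sdp \<Rightarrow> real \<Rightarrow>
    'n symmat \<Rightarrow> 'y \<times> 'w \<times> 'n symmat \<Rightarrow> ereal" where
  "zeta_gap P c X z = zeta P c X z - (INF z'\<in>dual_dom P. zeta P c X z')"

text \<open>Iterates of the method; how well \<open>(y, w)\<close> minimizes the subproblem is left to the
  stopping criteria below. The dual start \<open>z 0\<close> is arbitrary. The second formula for
  \<open>X (Suc k)\<close>, as a projection, follows from this one by Moreau's decomposition.\<close>
definition alm_sequence :: "('n::finite, 'y::euclidean_space, 'w::euclidean_space) sdp \<Rightarrow>
    (nat \<Rightarrow> real) \<Rightarrow> (nat \<Rightarrow> 'y \<times> 'w \<times> 'n symmat) \<Rightarrow> (nat \<Rightarrow> 'n symmat) \<Rightarrow> bool" where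
  "alm_sequence P c z X \<longleftrightarrow> X 0 \<in> psd_cone \<and>
     (\<forall>k. (case z (Suc k) of (y, w, S) \<Rightarrow> y \<in> Qset P \<and> S = S_update P (c k) (X k) y w) \<and>
          X (Suc k) = X k + c k *\<^sub>R dual_res P (z (Suc k)))"

definition crit_A' :: "('n::finite, 'y::euclidean_space, 'w::euclidean_space) sdp \<Rightarrow>
    (nat \<Rightarrow> real) \<Rightarrow> (nat \<Rightarrow> 'y \<times> 'w \<times> 'n symmat) \<Rightarrow> (nat \<Rightarrow> 'n symmat) \<Rightarrow>
    (nat \<Rightarrow> real) \<Rightarrow> bool" where
  "crit_A' P c z X \<epsilon> \<longleftrightarrow> (\<forall>k. 0 \<le> \<epsilon> k) \<and> summable \<epsilon> \<and>
     (\<forall>k. zeta_gap P (c k) (X k) (z (Suc k)) \<le> ereal ((\<epsilon> k)\<^sup>2 / (2 * c k)))"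

definition crit_B' :: "('n::finite, 'y::euclidean_space, 'w::euclidean_space) sdp \<Rightarrow>
    (nat \<Rightarrow> real) \<Rightarrow> (nat \<Rightarrow> 'y \<times> 'w \<times> 'n symmat) \<Rightarrow> (nat \<Rightarrow> 'n symmat) \<Rightarrow>
    (nat \<Rightarrow> real) \<Rightarrow> bool" where
  "crit_B' P c z X \<eta> \<longleftrightarrow> (\<forall>k. 0 \<le> \<eta> k) \<and> summable \<eta> \<and>
     (\<forall>k. zeta_gap P (c k) (X k) (z (Suc k)) \<le>
        ereal ((\<eta> k)\<^sup>2 / (2 * c k) * (norm (X (Suc k) - X k))\<^sup>2))"

definition crit_B'' :: "('n::finite, 'y::euclidean_space, 'w::euclidean_space) sdp \<Rightarrow>
    (nat \<Rightarrow> real) \<Rightarrow> (nat \<Rightarrow> 'y \<times> 'w \<times> 'n symmat) \<Rightarrow> (nat \<Rightarrow> 'n symmat) \<Rightarrow>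
    (nat \<Rightarrow> real) \<Rightarrow> bool" where
  "crit_B'' P c z X \<eta>' \<longleftrightarrow> (\<forall>k. 0 \<le> \<eta>' k) \<and> \<eta>' \<longlonglongrightarrow> 0 \<and>
     (\<forall>k. set_dist 0 (subdiff (zeta P (c k) (X k)) (z (Suc k))) \<le>
        ereal (\<eta>' k / c k * norm (X (Suc k) - X k)))"

definition over_cinf :: "real \<Rightarrow> ereal \<Rightarrow> real" where
  "over_cinf r cinf = (if cinf = \<infinity> then 0 else r / real_of_ereal cinf)"

definition theta :: "real \<Rightarrow> (nat \<Rightarrow> real) \<Rightarrow> (nat \<Rightarrow> real) \<Rightarrow> nat \<Rightarrow> real" where
  "theta \<kappa> c \<eta> k = (\<kappa> / sqrt (\<kappa>\<^sup>2 + (c k)\<^sup>2) + 2 * \<eta> k) * inverse (1 - \<eta> k)"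

definition theta_inf :: "real \<Rightarrow> ereal \<Rightarrow> real" where
  "theta_inf \<kappa> cinf = (if cinf = \<infinity> then 0 else \<kappa> / sqrt (\<kappa>\<^sup>2 + (real_of_ereal cinf)\<^sup>2))"

definition tau :: "(nat \<Rightarrow> real) \<Rightarrow> (nat \<Rightarrow> real) \<Rightarrow> nat \<Rightarrow> real" where
  "tau c \<eta> k = inverse (c k) * inverse (1 - \<eta> k)"

definition tau' :: "(nat \<Rightarrow> real) \<Rightarrow> (nat \<Rightarrow> real) \<Rightarrow> (nat \<Rightarrow> 'a::real_normed_vector) \<Rightarrow> nat \<Rightarrow> real" where
  "tau' c \<eta> X k = tau c \<eta> k *
     ((\<eta> k)\<^sup>2 * norm (X (Suc k) - X k) + norm (X (Suc k)) + norm (X k)) / 2"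

definition theta' :: "real \<Rightarrow> (nat \<Rightarrow> real) \<Rightarrow> (nat \<Rightarrow> real) \<Rightarrow> (nat \<Rightarrow> real) \<Rightarrow> nat \<Rightarrow> real" where
  "theta' \<kappa>\<^sub>l c \<eta> \<eta>' k = \<kappa>\<^sub>l * inverse (c k) * (1 + \<eta>' k) * inverse (1 - \<eta> k)"

end

theory Submission
  imports Defs
begin

text \<open>Up to the error allowed by the stopping criterion, an augmented Lagrangian step is a proximal
  step on the concave function \<open>phi\<close>: if \<open>r\<close> is the dual residual of \<open>z\<close>, then
  \<open>zeta z = l z Y - (norm (Y - X))\<^sup>2 / (2 * c) + (norm (Y - (X + c *\<^sub>R r)))\<^sup>2 / (2 * c)\<close> for every \<open>Y\<close>, so
  the gap of the subproblem bounds the distance of \<open>X + c *\<^sub>R r\<close> to the proximal point. Convergence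
  and the primal rate then follow from the three-point inequality of the proximal step (Fejer
  monotonicity and metric subregularity of the subgradient at the proximal point). The dual rate
  uses that a subgradient \<open>u\<close> of \<open>zeta\<close> at \<open>z\<close> gives the element \<open>(u, - r)\<close> of
  \<open>T_l (z, X + c *\<^sub>R r)\<close>.\<close>

subsection \<open>Inexact proximal steps\<close>

text \<open>The subproblems need not have minimizers and (D) need not have solutions, so the
  proximal point cannot be read off from an exact augmented Lagrangian step. It is built in the
  space of residuals instead: the penalty is strongly convex there, so the residuals of a minimizing
  sequence cluster even if the dual points themselves are unbounded. A second obstacle is that
  \<open>hfun\<close> is not assumed lower semicontinuous. Limits are therefore taken only in
  \<open>phi\<close>, an infimum of affine functions, and in the epigraph of the conjugate, an
  intersection of half-spaces. Maximizers of \<open>phi\<close> stand in for primal solutions;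
  \<open>mv_inverse_T_phi\<close> identifies the two once a primal solution exists. The criteria
  divide squares by \<open>2 * c k\<close> because the proximal term has this scale: a gap
  \<open>g\<close> displaces the new multiplier from the proximal point by at most
  \<open>sqrt (2 * c k * g)\<close>, which is \<open>\<epsilon> k\<close> under (A') and
  \<open>\<eta> k\<close> step lengths under (B').\<close>

lemma nonneg_intercept:
  fixes a b :: real
  assumes "\<And>s. 0 < s \<Longrightarrow> s \<le> 1 \<Longrightarrow> 0 \<le> a + s * b"
  shows "0 \<le> a"
proof (rule tendsto_lowerbound)
  have "((\<lambda>s. a + s * b) \<longlongrightarrow> a + 0 * b) (at_right 0)" by (intro tendsto_intros)
  then show "((\<lambda>s. a + s * b) \<longlongrightarrow> a) (at_right 0)" by simp
  show "\<forall>\<^sub>F s in at_right 0. 0 \<le> a + s * b"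
    unfolding eventually_at_right_field using assms by (intro exI[of _ 1]) auto
qed simp

text \<open>Strong convexity of the quadratic makes minimizing sequences bounded, so the minimum is
  approached at some \<open>r\<close>, although \<open>G\<close> need not be closed. The gradient \<open>x + c *\<^sub>R r\<close> of the
  quadratic is the required dual point.\<close>
lemma quadratic_regularization_dual:
  fixes G :: "('a::euclidean_space \<times> real) set"
  assumes G: "convex G" and c: "0 < c"
    and lower: "\<And>r t. (r, t) \<in> G \<Longrightarrow> m \<le> t + x \<bullet> r + c / 2 * (norm r)\<^sup>2"
    and approx: "\<And>e. 0 < e \<Longrightarrow> \<exists>r t. (r, t) \<in> G \<and> t + x \<bullet> r + c / 2 * (norm r)\<^sup>2 < m + e"
  obtains x' where
    "\<And>r t. (r, t) \<in> G \<Longrightarrow> m + (norm (x' - x))\<^sup>2 / (2 * c) \<le> t + x' \<bullet> r"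
    "\<And>y s. (\<And>r t. (r, t) \<in> G \<Longrightarrow> s \<le> t + y \<bullet> r) \<Longrightarrow>
       s + ((norm (y - x'))\<^sup>2 - (norm (y - x))\<^sup>2) / (2 * c) \<le> m"
proof -
  define q where "q r = x \<bullet> r + c / 2 * (norm r)\<^sup>2" for r
  have mix: "(1 - s) * t + s * t' + q ((1 - s) *\<^sub>R r + s *\<^sub>R r') \<ge> m"
    if "(r, t) \<in> G" "(r', t') \<in> G" "0 \<le> s" "s \<le> 1" for r t r' t' s
  proof -
    have "((1 - s) *\<^sub>R r + s *\<^sub>R r', (1 - s) * t + s * t') \<in> G"
      using convexD_alt[OF G that] by simp
    from lower[OF this] show ?thesis by (simp add: q_def)
  qed
  have qmid: "q ((1 - s) *\<^sub>R r + s *\<^sub>R r')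
      = (1 - s) * q r + s * q r' - s * (1 - s) * c / 2 * (norm (r - r'))\<^sup>2" for s r r'
    unfolding q_def power2_norm_eq_inner
    by (simp add: inner_add_left inner_add_right inner_diff_left inner_diff_right
        inner_commute[of r' r] field_simps power2_eq_square)
  have "\<forall>n. \<exists>p. p \<in> G \<and> snd p + q (fst p) < m + 1 / real (Suc n)"
  proof
    fix n
    obtain r t where "(r, t) \<in> G" "t + x \<bullet> r + c / 2 * (norm r)\<^sup>2 < m + 1 / real (Suc n)"
      using approx[of "1 / real (Suc n)"] by auto
    then show "\<exists>p. p \<in> G \<and> snd p + q (fst p) < m + 1 / real (Suc n)"
      by (intro exI[of _ "(r, t)"]) (simp add: q_def add.assoc)
  qed
  then obtain p where pG: "\<And>n. p n \<in> G" and p: "\<And>n. snd (p n) + q (fst (p n)) < m + 1 / real (Suc n)"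
    by metis
  define r t where "r n = fst (p n)" and "t n = snd (p n)" for n
  have rt: "(r n, t n) \<in> G" "t n + q (r n) < m + 1 / real (Suc n)" for n
    using pG p by (auto simp: r_def t_def)
  \<comment> \<open>By \<open>qmid\<close>, the value at a midpoint lies \<open>c / 8\<close> times
    the squared distance below the mean of the end values. It is still at least \<open>m\<close>,
    while both ends are within 1 of \<open>m\<close>.\<close>
  have "(norm (r 0 - r n))\<^sup>2 \<le> 8 / c" for n
  proof -
    have "m \<le> (t 0 + q (r 0)) / 2 + (t n + q (r n)) / 2 - c / 8 * (norm (r 0 - r n))\<^sup>2"
      using mix[OF rt(1)[of 0] rt(1)[of n], of "1/2"] qmid[of "1/2" "r 0" "r n"] by (simp add: field_simps)
    moreover have "t n + q (r n) < m + 1"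
      using rt(2)[of n] by (rule less_le_trans) simp
    moreover have "t 0 + q (r 0) < m + 1" using rt(2)[of 0] by simp
    ultimately have "c / 8 * (norm (r 0 - r n))\<^sup>2 \<le> 1" by argo
    then have "c * (norm (r 0 - r n))\<^sup>2 \<le> 8" by simp
    then show ?thesis using c by (simp add: pos_le_divide_eq mult.commute)
  qed
  then have "dist (r 0) (r n) \<le> sqrt (8 / c)" for n
    by (simp add: dist_norm real_le_rsqrt)
  then have "bounded (range r)" unfolding bounded_def by blast
  then obtain r' \<sigma> where \<sigma>: "strict_mono \<sigma>" and lim: "(r \<circ> \<sigma>) \<longlonglongrightarrow> r'"
    using bounded_imp_convergent_subsequence by blast
  have qlim: "(\<lambda>n. q (r (\<sigma> n))) \<longlonglongrightarrow> q r'"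
    using lim unfolding q_def o_def by (intro tendsto_intros) auto
  have "(\<lambda>n. 1 / real (Suc n)) \<longlonglongrightarrow> 0" by (rule LIMSEQ_Suc[OF lim_1_over_n])
  from LIMSEQ_subseq_LIMSEQ[OF this \<sigma>] have small: "(\<lambda>n. 1 / real (Suc (\<sigma> n))) \<longlonglongrightarrow> 0"
    by (simp add: o_def)
  have "(\<lambda>n. t (\<sigma> n) + q (r (\<sigma> n))) \<longlonglongrightarrow> m"
  proof (rule tendsto_sandwich[of "\<lambda>_. m" _ _ "\<lambda>n. m + 1 / real (Suc (\<sigma> n))"])
    show "\<forall>\<^sub>F n in sequentially. m \<le> t (\<sigma> n) + q (r (\<sigma> n))"
      using lower[OF rt(1)] by (auto simp: q_def add.assoc)
    show "\<forall>\<^sub>F n in sequentially. t (\<sigma> n) + q (r (\<sigma> n)) \<le> m + 1 / real (Suc (\<sigma> n))"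
      by (intro always_eventually allI less_imp_le rt(2))
    show "(\<lambda>n. m + 1 / real (Suc (\<sigma> n))) \<longlonglongrightarrow> m"
      using tendsto_add[OF tendsto_const[of m] small] by simp
  qed simp
  \<comment> \<open>The pair \<open>(r', m - q r')\<close> lies in the closure of \<open>G\<close>
    but perhaps not in \<open>G\<close>, so both claims below are obtained as limits along the
    sequence.\<close>
  from tendsto_diff[OF this qlim] have tlim: "(\<lambda>n. t (\<sigma> n)) \<longlonglongrightarrow> m - q r'" by simp
  define x' where "x' = x + c *\<^sub>R r'"
  have r': "r' = (1 / c) *\<^sub>R (x' - x)" using c by (simp add: x'_def)
  \<comment> \<open>Both sides are the convex conjugate of \<open>q\<close> at \<open>x'\<close>,
    which is the gradient of \<open>q\<close> at \<open>r'\<close>.\<close>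
  have q': "x' \<bullet> r' - q r' = (norm (x' - x))\<^sup>2 / (2 * c)"
    using c unfolding q_def x'_def power2_norm_eq_inner
    by (simp add: inner_add_left field_simps)
  show ?thesis
  proof (rule that)
    fix u v assume uv: "(u, v) \<in> G"
    \<comment> \<open>First-order optimality: move a fraction \<open>s\<close> from the limit pair
      towards \<open>(u, v)\<close>, expand the quadratic, divide by \<open>s\<close>, and let
      \<open>s\<close> tend to 0.\<close>
    have "0 \<le> (v - m + q r' + x' \<bullet> (u - r')) + s * (c / 2 * (norm (u - r'))\<^sup>2)"
      if s: "0 < s" "s \<le> 1" for s
    proof -
      have "(\<lambda>n. (1 - s) * t (\<sigma> n) + s * v + q ((1 - s) *\<^sub>R r (\<sigma> n) + s *\<^sub>R u)) \<longlonglongrightarrow>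
          (1 - s) * (m - q r') + s * v + q ((1 - s) *\<^sub>R r' + s *\<^sub>R u)"
        using lim tlim unfolding q_def o_def by (intro tendsto_intros) auto
      then have "m \<le> (1 - s) * (m - q r') + s * v + q ((1 - s) *\<^sub>R r' + s *\<^sub>R u)"
        by (rule LIMSEQ_le_const) (use mix[OF rt(1) uv] s in auto)
      also have "\<dots> = m + s * ((v - m + q r' + x' \<bullet> (u - r')) + s * (c / 2 * (norm (u - r'))\<^sup>2))"
        unfolding q_def x'_def power2_norm_eq_inner
        by (simp add: inner_add_left inner_add_right inner_diff_left inner_diff_right
            inner_commute[of r' u] field_simps power2_eq_square)
      finally show ?thesis using s by (simp add: zero_le_mult_iff)
    qed
    from nonneg_intercept[OF this] show "m + (norm (x' - x))\<^sup>2 / (2 * c) \<le> v + x' \<bullet> u"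
      by (simp add: q'[symmetric] inner_diff_right)
  next
    fix y s assume s: "\<And>r t. (r, t) \<in> G \<Longrightarrow> s \<le> t + y \<bullet> r"
    have "(\<lambda>n. t (\<sigma> n) + y \<bullet> r (\<sigma> n)) \<longlonglongrightarrow> m - q r' + y \<bullet> r'"
      using lim tlim unfolding o_def by (intro tendsto_intros)
    then have "s \<le> m - q r' + y \<bullet> r'"
      by (rule LIMSEQ_le_const) (use s rt(1) in auto)
    \<comment> \<open>The Fenchel-Young gap of \<open>q\<close> at the pair \<open>r'\<close>,
      \<open>y\<close> is exactly \<open>(norm (y - x'))\<^sup>2 / (2 * c)\<close>.\<close>
    moreover have "(norm (y - x'))\<^sup>2 - (norm (y - x))\<^sup>2 = 2 * c * (q r' - y \<bullet> r')"
      unfolding q_def x'_def power2_norm_eq_inner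
      by (simp add: inner_commute[of r' x] inner_commute[of r' y] inner_commute[of y x] algebra_simps)
    then have "((norm (y - x'))\<^sup>2 - (norm (y - x))\<^sup>2) / (2 * c) = q r' - y \<bullet> r'" using c by simp
    ultimately show "s + ((norm (y - x'))\<^sup>2 - (norm (y - x))\<^sup>2) / (2 * c) \<le> m" by simp
  qed
qed

section \<open>The inexact proximal point method for an extended-real function\<close>

definition argmax_set :: "('a \<Rightarrow> ereal) \<Rightarrow> 'a set" where
  "argmax_set f = {x. \<bar>f x\<bar> \<noteq> \<infinity> \<and> (\<forall>y. f y \<le> f x)}"

text \<open>For concave \<open>f\<close> this says that \<open>x'\<close> maximizes \<open>\<lambda>y. f y - (norm (y - x))\<^sup>2 / (2 * c)\<close>.\<close>
definition proximal_step :: "('a::real_inner \<Rightarrow> ereal) \<Rightarrow> real \<Rightarrow> 'a \<Rightarrow> 'a \<Rightarrow> bool" where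
  "proximal_step f c x x' \<longleftrightarrow> (\<forall>y s. ereal s \<le> f y \<longrightarrow>
     ereal (s + ((norm (y - x'))\<^sup>2 + (norm (x' - x))\<^sup>2 - (norm (y - x))\<^sup>2) / (2 * c)) \<le> f x')"

text \<open>The finiteness clause of \<open>argmax_set\<close> supplies the real \<open>M\<close>.
  The superlevel form is the one that passes to limits.\<close>

lemma argmax_setD:
  assumes "x \<in> argmax_set f"
  obtains M where "f x = ereal M" "\<And>y. f y \<le> ereal M" "argmax_set f = {y. ereal M \<le> f y}"
proof -
  obtain M where M: "f x = ereal M" using assms by (auto simp: argmax_set_def)
  have le: "f y \<le> ereal M" for y using assms M by (auto simp: argmax_set_def)
  have "argmax_set f = {y. ereal M \<le> f y}"
  proof (intro equalityI subsetI CollectI)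
    fix y assume "y \<in> argmax_set f"
    then have "f x \<le> f y" by (simp add: argmax_set_def)
    then show "ereal M \<le> f y" by (simp add: M)
  next
    fix y assume "y \<in> {y. ereal M \<le> f y}"
    then have "f y = ereal M" using le by (auto intro: antisym)
    then show "y \<in> argmax_set f" using le by (simp add: argmax_set_def)
  qed
  then show ?thesis using that M le by blast
qed

text \<open>The three-point inequality is tested at a maximizer: its value dominates
  \<open>f x'\<close>, so only the quadratic terms survive.\<close>

lemma proximal_step_fejer:
  assumes "proximal_step f c x x'" "0 < c" "p \<in> argmax_set f"
  shows "(norm (p - x'))\<^sup>2 + (norm (x' - x))\<^sup>2 \<le> (norm (p - x))\<^sup>2"
proof -
  obtain M where M: "f p = ereal M" "\<And>y. f y \<le> ereal M" using argmax_setD[OF assms(3)] by metis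
  have "ereal (M + ((norm (p - x'))\<^sup>2 + (norm (x' - x))\<^sup>2 - (norm (p - x))\<^sup>2) / (2 * c)) \<le> f x'"
    by (rule assms(1)[unfolded proximal_step_def, rule_format]) (simp add: M(1))
  also have "\<dots> \<le> ereal M" by (rule M)
  finally show ?thesis using assms(2) by (simp add: divide_le_0_iff)
qed

text \<open>The three squares polarize to \<open>2 * ((x - x') \<bullet> (y - x'))\<close>, so the
  three-point inequality is the subgradient inequality in disguise. The maximizer \<open>p\<close>
  makes \<open>f x'\<close> finite.\<close>

lemma proximal_step_subgradient:
  assumes step: "proximal_step f c x x'" and c: "0 < c" and p: "p \<in> argmax_set f"
  shows "(1 / c) *\<^sub>R (x - x') \<in> subdiff (\<lambda>x. - f x) x'"
proof -
  obtain M where M: "f p = ereal M" "\<And>y. f y \<le> ereal M" using argmax_setD[OF p] by metis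
  have "ereal (M + ((norm (p - x'))\<^sup>2 + (norm (x' - x))\<^sup>2 - (norm (p - x))\<^sup>2) / (2 * c)) \<le> f x'"
    by (rule step[unfolded proximal_step_def, rule_format]) (simp add: M(1))
  then obtain v where v: "f x' = ereal v" using M(2)[of x'] by (cases "f x'") auto
  have "- f x' + ereal (((1 / c) *\<^sub>R (x - x')) \<bullet> (y - x')) \<le> - f y" for y
  proof (cases "f y")
    case (real s)
    have "ereal (s + ((norm (y - x'))\<^sup>2 + (norm (x' - x))\<^sup>2 - (norm (y - x))\<^sup>2) / (2 * c)) \<le> f x'"
      by (rule step[unfolded proximal_step_def, rule_format]) (simp add: real)
    then have "s + ((norm (y - x'))\<^sup>2 + (norm (x' - x))\<^sup>2 - (norm (y - x))\<^sup>2) / (2 * c) \<le> v" by (simp add: v)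
    moreover have "(norm (y - x'))\<^sup>2 + (norm (x' - x))\<^sup>2 - (norm (y - x))\<^sup>2 = 2 * ((x - x') \<bullet> (y - x'))"
      unfolding power2_norm_eq_inner
      by (simp add: inner_diff_left inner_diff_right inner_commute[of x' x] inner_commute[of x' y] inner_commute[of y x])
    ultimately have "s + ((x - x') \<bullet> (y - x')) / c \<le> v" by simp
    then have "- v + ((1 / c) *\<^sub>R (x - x')) \<bullet> (y - x') \<le> - s" by simp
    then have "ereal (- v + ((1 / c) *\<^sub>R (x - x')) \<bullet> (y - x')) \<le> ereal (- s)"
      unfolding ereal_less_eq .
    then show ?thesis unfolding v real by simp
  next
    case PInf then show ?thesis using M(2)[of y] by simp
  qed (simp add: v)
  then show ?thesis by (simp add: subdiff_def v)
qed

text \<open>Subtracting the accumulated errors leaves a decreasing sequence, bounded below by minus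
  the total error.\<close>

lemma quasi_decreasing_convergent:
  fixes a \<epsilon> :: "nat \<Rightarrow> real"
  assumes "\<And>k. 0 \<le> a k" "\<And>k. a (Suc k) \<le> a k + \<epsilon> k" "\<And>k. 0 \<le> \<epsilon> k" "summable \<epsilon>"
  shows "convergent a"
proof -
  let ?b = "\<lambda>k. a k - sum \<epsilon> {..<k}"
  have "decseq ?b" using assms(2) by (intro decseq_SucI) (simp add: algebra_simps)
  moreover have "- suminf \<epsilon> \<le> ?b k" for k
    using assms(1)[of k] sum_le_suminf[OF assms(4), of "{..<k}"] assms(3) by simp
  ultimately obtain L where "?b \<longlonglongrightarrow> L" using decseq_convergent by blast
  from tendsto_add[OF this summable_LIMSEQ[OF assms(4)]] have "a \<longlonglongrightarrow> L + suminf \<epsilon>" by simp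
  then show ?thesis by (rule convergentI)
qed

text \<open>Opial's argument. Up to summable errors the distance to every maximizer decreases, hence
  converges, and the proximal steps vanish. Closed superlevel sets make some accumulation point
  \<open>x\<close> a maximizer. The distance to this \<open>x\<close> converges too, and along the
  subsequence its limit is 0.\<close>

lemma inexact_proximal_point_convergence:
  fixes f :: "'a::euclidean_space \<Rightarrow> ereal"
  assumes closed: "\<And>s. closed {x. ereal s \<le> f x}" and ne: "argmax_set f \<noteq> {}"
    and c: "0 < c0" "\<And>k. c0 \<le> c k"
    and step: "\<And>k. proximal_step f (c k) (X k) (X' k)"
    and err: "\<And>k. norm (X (Suc k) - X' k) \<le> \<epsilon> k" and eps: "summable \<epsilon>"
  obtains x where "x \<in> argmax_set f" "X \<longlonglongrightarrow> x" "X' \<longlonglongrightarrow> x"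
proof -
  have ck: "0 < c k" for k using c less_le_trans by blast
  have e0: "0 \<le> \<epsilon> k" for k using err[of k] norm_ge_zero order_trans by blast
  have fejer: "(norm (p - X' k))\<^sup>2 + (norm (X' k - X k))\<^sup>2 \<le> (norm (p - X k))\<^sup>2"
    if "p \<in> argmax_set f" for p k by (rule proximal_step_fejer[OF step ck that])
  have fejer': "norm (p - X' k) \<le> norm (p - X k)" if "p \<in> argmax_set f" for p k
  proof (rule power2_le_imp_le)
    show "(norm (p - X' k))\<^sup>2 \<le> (norm (p - X k))\<^sup>2"
      using fejer[OF that, of k] zero_le_power2[of "norm (X' k - X k)"] by linarith
  qed simp
  have tri: "norm (p - X (Suc k)) \<le> norm (p - X' k) + \<epsilon> k" for p k
    using norm_triangle_ineq[of "p - X' k" "X' k - X (Suc k)"] err[of k]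
    by (simp add: norm_minus_commute)
  have conv: "convergent (\<lambda>k. norm (p - X k))" if p: "p \<in> argmax_set f" for p
  proof (rule quasi_decreasing_convergent[OF _ _ e0 eps])
    show "norm (p - X (Suc k)) \<le> norm (p - X k) + \<epsilon> k" for k
      using tri[of p k] fejer'[OF p, of k] by linarith
  qed simp
  obtain p where p: "p \<in> argmax_set f" using ne by blast
  obtain M where M: "f p = ereal M" "\<And>y. f y \<le> ereal M" "argmax_set f = {y. ereal M \<le> f y}"
    using argmax_setD[OF p] by metis
  obtain L where L: "(\<lambda>k. norm (p - X k)) \<longlonglongrightarrow> L" using conv[OF p] by (auto simp: convergent_def)
  have eps0: "\<epsilon> \<longlonglongrightarrow> 0" by (rule summable_LIMSEQ_zero[OF eps])
  have L': "(\<lambda>k. norm (p - X' k)) \<longlonglongrightarrow> L"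
  proof (rule tendsto_sandwich)
    show "(\<lambda>k. norm (p - X (Suc k)) - \<epsilon> k) \<longlonglongrightarrow> L"
      using tendsto_diff[OF LIMSEQ_Suc[OF L] eps0] by simp
    show "\<forall>\<^sub>F k in sequentially. norm (p - X (Suc k)) - \<epsilon> k \<le> norm (p - X' k)"
      using tri[of p] by (intro always_eventually allI) (simp add: diff_le_eq)
    show "\<forall>\<^sub>F k in sequentially. norm (p - X' k) \<le> norm (p - X k)"
      using fejer'[OF p] by simp
  qed (rule L)
  have sq: "(\<lambda>k. (norm (p - X k))\<^sup>2 - (norm (p - X' k))\<^sup>2) \<longlonglongrightarrow> 0"
    using tendsto_diff[OF tendsto_power[OF L, of 2] tendsto_power[OF L', of 2]] by simp
  have sq': "(\<lambda>k. (norm (X' k - X k))\<^sup>2) \<longlonglongrightarrow> 0"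
    by (rule tendsto_sandwich[OF _ _ tendsto_const sq])
      (use fejer[OF p] in \<open>auto intro!: always_eventually simp: le_diff_eq add.commute\<close>)
  then have diff: "(\<lambda>k. X' k - X k) \<longlonglongrightarrow> 0"
    using tendsto_real_sqrt[OF sq'] by (simp add: tendsto_norm_zero_iff)
  obtain B where B: "\<And>k. norm (p - X k) \<le> B"
    using convergent_imp_Bseq[OF conv[OF p]] by (auto simp: Bseq_def)
  have "norm (X k) \<le> B + norm p" for k
    using B[of k] norm_triangle_ineq4[of p "p - X k"] by simp
  then have "bounded (range X)" by (auto simp: bounded_iff)
  then obtain x \<sigma> where \<sigma>: "strict_mono \<sigma>" and x: "(X \<circ> \<sigma>) \<longlonglongrightarrow> x"
    using bounded_imp_convergent_subsequence by blast
  have x': "(X' \<circ> \<sigma>) \<longlonglongrightarrow> x"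
    using tendsto_add[OF LIMSEQ_subseq_LIMSEQ[OF diff \<sigma>] x] by (simp add: o_def)
  have "ereal M \<le> f x"
  proof (rule ereal_le_epsilon2)
    fix e :: real assume e: "0 < e"
    \<comment> \<open>\<open>d k\<close> is the slack in the Fejer inequality at \<open>p\<close>;
      the three-point inequality makes \<open>X' k\<close> optimal up to
      \<open>d k / (2 * c k)\<close>. As \<open>d k\<close> is nonnegative, replacing
      \<open>c k\<close> by \<open>c0\<close> only enlarges this error.\<close>
    define d where "d k = (norm (p - X k))\<^sup>2 - (norm (p - X' k))\<^sup>2 - (norm (X' k - X k))\<^sup>2" for k
    have "d \<longlonglongrightarrow> 0" unfolding d_def using tendsto_diff[OF sq sq'] by simp
    then have "\<forall>\<^sub>F k in sequentially. d k < 2 * c0 * e"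
      by (rule order_tendstoD) (use c e in simp)
    then have "\<forall>\<^sub>F k in sequentially. ereal (M - e) \<le> f (X' k)"
    proof eventually_elim
      case (elim k)
      have "d k / (2 * c k) \<le> d k / (2 * c0)"
        using c(1) ck[of k] c(2)[of k] fejer[OF p, of k] by (intro divide_left_mono mult_pos_pos) (auto simp: d_def)
      also have "\<dots> \<le> e" using elim c by (simp add: field_simps)
      finally have "M - e \<le> M + ((norm (p - X' k))\<^sup>2 + (norm (X' k - X k))\<^sup>2 - (norm (p - X k))\<^sup>2) / (2 * c k)"
        by (simp add: d_def diff_divide_distrib add_divide_distrib)
      then have "ereal (M - e) \<le> ereal \<dots>" by simp
      also have "\<dots> \<le> f (X' k)"
        by (rule step[unfolded proximal_step_def, rule_format]) (simp add: M(1))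
      finally show ?case .
    qed
    from eventually_subseq[OF \<sigma> this]
    have ev: "\<forall>\<^sub>F k in sequentially. (X' \<circ> \<sigma>) k \<in> {x. ereal (M - e) \<le> f x}" by simp
    have "x \<in> {x. ereal (M - e) \<le> f x}"
      by (rule Lim_in_closed_set[OF closed ev _ x']) simp
    then show "ereal M \<le> f x + ereal e"
      by (cases "f x") (auto simp: algebra_simps)
  qed
  then have xm: "x \<in> argmax_set f" using M by simp
  obtain l where l: "(\<lambda>k. norm (x - X k)) \<longlonglongrightarrow> l" using conv[OF xm] by (auto simp: convergent_def)
  have "(\<lambda>k. norm (x - (X \<circ> \<sigma>) k)) \<longlonglongrightarrow> norm (x - x)" by (intro tendsto_intros x)
  moreover have "(\<lambda>k. norm (x - (X \<circ> \<sigma>) k)) \<longlonglongrightarrow> l"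
    using LIMSEQ_subseq_LIMSEQ[OF l \<sigma>] by (simp add: o_def)
  ultimately have "l = 0" using LIMSEQ_unique by fastforce
  then have "(\<lambda>k. x - X k) \<longlonglongrightarrow> 0" using l by (simp add: tendsto_norm_zero_iff)
  from tendsto_diff[OF tendsto_const[of x] this] have Xx: "X \<longlonglongrightarrow> x" by simp
  moreover have "X' \<longlonglongrightarrow> x" using tendsto_add[OF diff Xx] by simp
  ultimately show ?thesis using that xm by blast
qed

text \<open>The Fejer inequality at the maximizer nearest to \<open>x\<close>, which exists because
  the set is closed.\<close>

lemma proximal_step_infdist:
  fixes f :: "'a::euclidean_space \<Rightarrow> ereal"
  assumes step: "proximal_step f c x x'" and c: "0 < c"
    and ne: "argmax_set f \<noteq> {}" and closed: "closed (argmax_set f)"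
  shows "(infdist x' (argmax_set f))\<^sup>2 + (norm (x' - x))\<^sup>2 \<le> (infdist x (argmax_set f))\<^sup>2"
proof -
  obtain p where p: "p \<in> argmax_set f" "infdist x (argmax_set f) = dist x p"
    using infdist_attains_inf[OF closed ne] by metis
  have "(infdist x' (argmax_set f))\<^sup>2 \<le> (norm (p - x'))\<^sup>2"
    using infdist_le[OF p(1), of x'] by (intro power_mono infdist_nonneg) (simp add: dist_norm norm_minus_commute)
  with proximal_step_fejer[OF step c p(1)] show ?thesis
    by (simp add: p(2) dist_norm norm_minus_commute)
qed

text \<open>With d the distance to the maximizers, inserting the subregularity bound into
  \<open>proximal_step_infdist\<close> gives (1 + c^2 / kappa^2) d(x')^2 \<le> d(x)^2; this is the
  origin of \<open>\<kappa> / sqrt (\<kappa>\<^sup>2 + c\<^sup>2)\<close>. The factor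
  \<open>inverse (1 - \<eta>)\<close> appears because the error is relative to the inexact step,
  which is first bounded by the exact one.\<close>

lemma inexact_proximal_contraction:
  fixes f :: "'a::euclidean_space \<Rightarrow> ereal"
  assumes step: "proximal_step f c x x'" and c: "0 < c"
    and ne: "argmax_set f \<noteq> {}" and closed: "closed (argmax_set f)"
    and err: "norm (xn - x') \<le> \<eta> * norm (xn - x)" and eta: "0 \<le> \<eta>" "\<eta> < 1"
  shows inexact_step_le_infdist: "norm (xn - x) \<le> inverse (1 - \<eta>) * infdist x (argmax_set f)"
    and "0 < \<kappa> \<Longrightarrow> infdist x' (argmax_set f) \<le> \<kappa> * (norm (x - x') / c) \<Longrightarrow>
      infdist xn (argmax_set f)
        \<le> (\<kappa> / sqrt (\<kappa>\<^sup>2 + c\<^sup>2) + 2 * \<eta>) * inverse (1 - \<eta>) * infdist x (argmax_set f)"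
proof -
  let ?d = "\<lambda>y. infdist y (argmax_set f)"
  note sq = proximal_step_infdist[OF step c ne closed]
  have d0: "0 \<le> ?d y" for y by (rule infdist_nonneg)
  have "(norm (x' - x))\<^sup>2 \<le> (?d x)\<^sup>2" using sq zero_le_power2[of "?d x'"] by linarith
  then have "norm (x' - x) \<le> ?d x" by (rule power2_le_imp_le[OF _ d0])
  then have "(1 - \<eta>) * norm (xn - x) \<le> ?d x"
    using norm_triangle_ineq[of "xn - x'" "x' - x"] err by (simp add: left_diff_distrib)
  then show len: "norm (xn - x) \<le> inverse (1 - \<eta>) * ?d x"
    using eta unfolding inverse_eq_divide by (simp add: pos_le_divide_eq mult.commute)
  assume k: "0 < \<kappa>" and sub: "?d x' \<le> \<kappa> * (norm (x - x') / c)"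
  let ?q = "\<kappa> / sqrt (\<kappa>\<^sup>2 + c\<^sup>2)"
  have "(c * ?d x')\<^sup>2 \<le> (\<kappa> * norm (x' - x))\<^sup>2"
    using sub c d0[of x'] by (intro power_mono) (simp_all add: field_simps norm_minus_commute)
  moreover have "\<kappa>\<^sup>2 * ((?d x')\<^sup>2 + (norm (x' - x))\<^sup>2) \<le> \<kappa>\<^sup>2 * (?d x)\<^sup>2"
    using sq by (intro mult_left_mono) auto
  ultimately have "(\<kappa>\<^sup>2 + c\<^sup>2) * (?d x')\<^sup>2 \<le> (\<kappa> * ?d x)\<^sup>2"
    by (simp add: power_mult_distrib algebra_simps)
  then have "(sqrt (\<kappa>\<^sup>2 + c\<^sup>2) * ?d x')\<^sup>2 \<le> (\<kappa> * ?d x)\<^sup>2"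
    by (simp add: power_mult_distrib)
  then have "sqrt (\<kappa>\<^sup>2 + c\<^sup>2) * ?d x' \<le> \<kappa> * ?d x"
    by (rule power2_le_imp_le) (use k d0 in simp)
  moreover have "0 < sqrt (\<kappa>\<^sup>2 + c\<^sup>2)" using k by (simp add: add_pos_nonneg)
  ultimately have x': "?d x' \<le> ?q * ?d x" by (simp add: field_simps)
  have q0: "0 \<le> ?q" using k by simp
  have "?d xn \<le> ?d x' + norm (xn - x')"
    using infdist_triangle[of xn "argmax_set f" x'] by (simp add: dist_norm)
  also have "\<dots> \<le> ?q * ?d x + \<eta> * (inverse (1 - \<eta>) * ?d x)"
    using x' err mult_left_mono[OF len eta(1)] by linarith
  also have "\<dots> = (?q * (1 - \<eta>) + \<eta>) * inverse (1 - \<eta>) * ?d x"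
    using eta by (simp add: field_simps)
  \<comment> \<open>The numerator obtained so far is sharper; it is weakened to match
    \<open>theta\<close>.\<close>
  also have "\<dots> \<le> (?q + 2 * \<eta>) * inverse (1 - \<eta>) * ?d x"
  proof (intro mult_right_mono d0)
    have "?q * (1 - \<eta>) \<le> ?q" using q0 eta by (intro mult_left_le) auto
    then show "?q * (1 - \<eta>) + \<eta> \<le> ?q + 2 * \<eta>" using eta by simp
  qed (use eta in simp)
  finally show "?d xn \<le> (?q + 2 * \<eta>) * inverse (1 - \<eta>) * ?d x" .
qed

subsection \<open>The dual epigraph\<close>

text \<open>Points where \<open>f\<close> is infinite contribute \<open>-\<infinity>\<close> to the
  supremum. What remains are real inequalities affine in \<open>(w, t)\<close>, from which
  closedness and convexity can be read off.\<close>

lemma conjugate_le_iff: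
  assumes "\<And>x. f x \<noteq> -\<infinity>"
  shows "conjugate f w \<le> ereal t \<longleftrightarrow> (\<forall>x a. f x = ereal a \<longrightarrow> w \<bullet> x - a \<le> t)"
proof (intro iffI allI impI)
  fix x a assume le: "conjugate f w \<le> ereal t" and a: "f x = ereal a"
  have "ereal (w \<bullet> x) - f x \<le> conjugate f w" unfolding conjugate_def by (rule SUP_upper) simp
  from order_trans[OF this le] show "w \<bullet> x - a \<le> t" by (simp add: a)
next
  assume *: "\<forall>x a. f x = ereal a \<longrightarrow> w \<bullet> x - a \<le> t"
  show "conjugate f w \<le> ereal t" unfolding conjugate_def
  proof (rule SUP_least)
    fix x show "ereal (w \<bullet> x) - f x \<le> ereal t"
      using * assms[of x] by (cases "f x") auto
  qed
qed

lemma dual_obj_le_iff: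
  fixes P :: "('n::finite, 'y::euclidean_space, 'w::euclidean_space) sdp"
  assumes "sdp_data P"
  shows "dual_obj P z \<le> ereal t \<longleftrightarrow>
    (\<forall>x a. hfun P x = ereal a \<longrightarrow> - (bvec P \<bullet> fst z) - fst (snd z) \<bullet> x - a \<le> t)"
proof -
  have "\<And>x. hfun P x \<noteq> -\<infinity>" using assms by (simp add: sdp_data_def)
  note le = conjugate_le_iff[OF this, where w = "- fst (snd z)" and t = "t + bvec P \<bullet> fst z"]
  have "dual_obj P z \<le> ereal t \<longleftrightarrow> conjugate (hfun P) (- fst (snd z)) \<le> ereal (t + bvec P \<bullet> fst z)"
    by (cases z; cases "conjugate (hfun P) (- fst (snd z))") (auto simp: dual_obj_def)
  moreover have "- w \<bullet> x - a \<le> t + u \<longleftrightarrow> - u - w \<bullet> x - a \<le> t" for w x :: 'w and a u by auto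
  ultimately show ?thesis unfolding le by simp
qed

text \<open>Self-duality writes the cone as an intersection of half-spaces, so its topology and
  convexity require no matrix argument.\<close>

lemma psd_cone_eq_Inter: "psd_cone = (\<Inter>S\<in>psd_cone. {X. 0 \<le> S \<bullet> X})"
proof (intro equalityI subsetI INT_I CollectI)
  fix X :: "'a symmat" assume "X \<in> (\<Inter>S\<in>psd_cone. {X. 0 \<le> S \<bullet> X})"
  then show "X \<in> psd_cone" by (intro psd_cone_self_dual) (simp add: inner_commute[of X])
qed (rule psd_cone_inner_nonneg)

lemma closed_psd_cone: "closed psd_cone"
  by (subst psd_cone_eq_Inter) (intro closed_INT ballI closed_Collect_le continuous_intros)

lemma convex_psd_cone: "convex psd_cone"
  by (subst psd_cone_eq_Inter) (intro convex_INT convex_halfspace_ge)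

lemma zero_in_psd_cone: "0 \<in> psd_cone"
  by (simp add: psd_cone_def zero_symmat.rep_eq)

lemma closed_dual_dom: "sdp_data P \<Longrightarrow> closed (dual_dom P)"
  unfolding dual_dom_def sdp_data_def
  by (intro closed_Times closed_psd_cone polyhedron_imp_closed) auto

lemma convex_dual_dom: "sdp_data P \<Longrightarrow> convex (dual_dom P)"
  unfolding dual_dom_def sdp_data_def
  by (intro convex_Times convex_psd_cone polyhedron_imp_convex) auto

text \<open>Pairs with a real level keep the infinite values of the conjugate out of all convexity
  and limit arguments.\<close>

definition dual_epi :: "('n::finite, 'y::euclidean_space, 'w::euclidean_space) sdp \<Rightarrow>
    (('y \<times> 'w \<times> 'n symmat) \<times> real) set" where
  "dual_epi P = {(z, t). z \<in> dual_dom P \<and> dual_obj P z \<le> ereal t}"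

text \<open>A conjugate is a supremum of affine functions, so its epigraph is an intersection of
  half-spaces, closed for every \<open>hfun\<close>.\<close>

lemma dual_epi_eq_Inter:
  fixes P :: "('n::finite, 'y::euclidean_space, 'w::euclidean_space) sdp"
  assumes "sdp_data P"
  shows "dual_epi P = dual_dom P \<times> UNIV \<inter> (\<Inter>(x, a)\<in>{(x, a). hfun P x = ereal a}.
    {p. 0 \<le> snd p + bvec P \<bullet> fst (fst p) + x \<bullet> fst (snd (fst p)) + a})"
proof -
  have "- u - w \<bullet> x - a \<le> t \<longleftrightarrow> 0 \<le> t + u + x \<bullet> w + a" for u a t :: real and w x :: 'w
    using inner_commute[of w x] by auto
  then show ?thesis by (auto simp: dual_epi_def dual_obj_le_iff[OF assms])
qed

lemma closed_dual_epi: "sdp_data P \<Longrightarrow> closed (dual_epi P)"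
  unfolding dual_epi_eq_Inter
  by (intro closed_Int closed_Times closed_UNIV closed_dual_dom closed_INT)
    (auto intro!: closed_Collect_le continuous_intros)

lemma dual_epi_convex_comb:
  assumes P: "sdp_data P" and zt: "(z, t) \<in> dual_epi P" "(z', t') \<in> dual_epi P" "0 \<le> s" "s \<le> 1"
  shows "((1 - s) *\<^sub>R z + s *\<^sub>R z', (1 - s) * t + s * t') \<in> dual_epi P"
proof -
  have "(1 - s) *\<^sub>R z + s *\<^sub>R z' \<in> dual_dom P"
    using zt by (intro convexD_alt[OF convex_dual_dom[OF P]]) (auto simp: dual_epi_def)
  moreover have "- (bvec P \<bullet> fst ((1 - s) *\<^sub>R z + s *\<^sub>R z')) - fst (snd ((1 - s) *\<^sub>R z + s *\<^sub>R z')) \<bullet> x - a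
      \<le> (1 - s) * t + s * t'" if "hfun P x = ereal a" for x a
  proof -
    have "(1 - s) * (- (bvec P \<bullet> fst z) - fst (snd z) \<bullet> x - a)
        + s * (- (bvec P \<bullet> fst z') - fst (snd z') \<bullet> x - a) \<le> (1 - s) * t + s * t'"
      using zt that by (intro add_mono mult_left_mono) (auto simp: dual_epi_def dual_obj_le_iff[OF P])
    then show ?thesis by (simp add: algebra_simps)
  qed
  ultimately show ?thesis by (simp add: dual_epi_def dual_obj_le_iff[OF P])
qed

lemma dual_epiE:
  assumes P: "sdp_data P" and "(z, t) \<in> dual_epi P"
  obtains d where "z \<in> dual_dom P" "dual_obj P z = ereal d" "d \<le> t"
  using assms dual_obj_not_MInf[OF P, of z] by (cases "dual_obj P z") (auto simp: dual_epi_def)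

lemma dual_res_convex_comb:
  assumes P: "sdp_data P"
  shows "dual_res P ((1 - s) *\<^sub>R z + s *\<^sub>R z') = (1 - s) *\<^sub>R dual_res P z + s *\<^sub>R dual_res P z'"
proof -
  have lin: "linear (adjoint (Amap P))" "linear (adjoint (Fmap P))"
    using P by (auto simp: sdp_data_def intro: adjoint_linear)
  show ?thesis
    by (cases z; cases z') (simp add: dual_res_def linear_add[OF lin(1)] linear_add[OF lin(2)]
        linear_diff[OF lin(1)] linear_diff[OF lin(2)]
        linear_scale[OF lin(1)] linear_scale[OF lin(2)] algebra_simps)
qed

lemma continuous_on_dual_res:
  assumes P: "sdp_data P"
  shows "continuous_on A (dual_res P)"
proof -
  have lin: "linear (adjoint (Amap P))" "linear (adjoint (Fmap P))"
    using P by (auto simp: sdp_data_def intro: adjoint_linear)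
  have "continuous_on A (\<lambda>z. adjoint (Amap P) (fst z))"
    by (rule linear_continuous_on_compose[OF _ lin(1)]) (intro continuous_intros)
  moreover have "continuous_on A (\<lambda>z. adjoint (Fmap P) (fst (snd z)))"
    by (rule linear_continuous_on_compose[OF _ lin(2)]) (intro continuous_intros)
  ultimately show ?thesis unfolding dual_res_def case_prod_unfold
    by (intro continuous_intros)
qed

text \<open>Up to unattained infima this is the epigraph of the perturbation function, the infimum
  of \<open>dual_obj P z\<close> subject to \<open>dual_res P z = r\<close>. As an affine image of a
  closed set it need not be closed.\<close>

definition dual_graph :: "('n::finite, 'y::euclidean_space, 'w::euclidean_space) sdp \<Rightarrow>
    ('n symmat \<times> real) set" where
  "dual_graph P = {(r, t). \<exists>z. (z, t) \<in> dual_epi P \<and> r = dual_res P z}"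

lemma mem_dual_graph: "(r, t) \<in> dual_graph P \<longleftrightarrow> (\<exists>z. (z, t) \<in> dual_epi P \<and> r = dual_res P z)"
  unfolding dual_graph_def by (simp only: mem_Collect_eq prod.case)

lemma dual_graphI: "z \<in> dual_dom P \<Longrightarrow> dual_obj P z = ereal t \<Longrightarrow> (dual_res P z, t) \<in> dual_graph P"
  unfolding mem_dual_graph by (intro exI[of _ z]) (simp add: dual_epi_def)

lemma convex_dual_graph:
  assumes P: "sdp_data P"
  shows "convex (dual_graph P)"
  unfolding convex_alt
proof (intro ballI allI impI)
  fix p p' and s :: real assume "p \<in> dual_graph P" "p' \<in> dual_graph P" and s: "0 \<le> s \<and> s \<le> 1"
  then obtain z z' where zt: "(z, snd p) \<in> dual_epi P" "(z', snd p') \<in> dual_epi P"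
    and p: "fst p = dual_res P z" "fst p' = dual_res P z'"
    using mem_dual_graph by (metis prod.collapse)
  have "(dual_res P ((1 - s) *\<^sub>R z + s *\<^sub>R z'), (1 - s) * snd p + s * snd p') \<in> dual_graph P"
    unfolding mem_dual_graph using dual_epi_convex_comb[OF P zt, of s] s by blast
  then show "(1 - s) *\<^sub>R p + s *\<^sub>R p' \<in> dual_graph P"
    by (cases p; cases p') (use p in \<open>simp add: dual_res_convex_comb[OF P]\<close>)
qed

text \<open>Points with infinite dual objective do not affect the infimum in \<open>phi\<close>. The
  resulting real affine constraints on \<open>X\<close> give closed superlevel sets and have the
  form required by \<open>quadratic_regularization_dual\<close>.\<close>

lemma phi_ge_iff:
  assumes P: "sdp_data P"
  shows "ereal s \<le> phi P X \<longleftrightarrow> (\<forall>r t. (r, t) \<in> dual_graph P \<longrightarrow> s \<le> t + X \<bullet> r)"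
proof
  assume le: "ereal s \<le> phi P X"
  show "\<forall>r t. (r, t) \<in> dual_graph P \<longrightarrow> s \<le> t + X \<bullet> r"
  proof (intro allI impI)
    fix r t assume "(r, t) \<in> dual_graph P"
    then obtain z where z: "(z, t) \<in> dual_epi P" "r = dual_res P z" unfolding mem_dual_graph by blast
    obtain d where d: "z \<in> dual_dom P" "dual_obj P z = ereal d" "d \<le> t" using dual_epiE[OF P z(1)] .
    have "ereal s \<le> lagr P z X"
      using le INF_lower[of z UNIV "\<lambda>z. lagr P z X"] unfolding phi_def by (meson UNIV_I order_trans)
    then show "s \<le> t + X \<bullet> r" using d z by (simp add: lagr_def)
  qed
next
  assume *: "\<forall>r t. (r, t) \<in> dual_graph P \<longrightarrow> s \<le> t + X \<bullet> r"
  show "ereal s \<le> phi P X" unfolding phi_def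
  proof (rule INF_greatest)
    fix z
    show "ereal s \<le> lagr P z X"
    proof (cases "z \<in> dual_dom P \<and> dual_obj P z \<noteq> \<infinity>")
      case True
      then obtain d where d: "dual_obj P z = ereal d"
        using dual_obj_not_MInf[OF P] by (cases "dual_obj P z") auto
      then have "(dual_res P z, d) \<in> dual_graph P"
        using True by (intro dual_graphI) auto
      then show ?thesis using * True d by (simp add: lagr_def)
    qed (auto simp: lagr_def)
  qed
qed

lemma closed_phi_superlevel: "sdp_data P \<Longrightarrow> closed {X. ereal s \<le> phi P X}"
  unfolding phi_ge_iff
  by (intro closed_Collect_all closed_Collect_imp closed_Collect_le continuous_intros) simp

lemma zeros_T_phi: "mv_inverse (T_phi P) 0 = argmax_set (phi P)"
  unfolding mv_inverse_def T_phi_def subdiff_def argmax_set_def mem_Collect_eq inner_zero_left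
    zero_ereal_def[symmetric] add_0_right ereal_minus_le_minus abs_ereal_uminus ..

lemma closed_argmax_phi:
  assumes "sdp_data P"
  shows "closed (argmax_set (phi P))"
proof (cases "argmax_set (phi P) = {}")
  case False
  then obtain p where "p \<in> argmax_set (phi P)" by blast
  then obtain M where "argmax_set (phi P) = {X. ereal M \<le> phi P X}" by (rule argmax_setD)
  then show ?thesis using closed_phi_superlevel[OF assms] by simp
qed simp

subsection \<open>The augmented Lagrangian step as a proximal step\<close>

lemma zeta_eq:
  assumes "z \<in> dual_dom P" "dual_obj P z = ereal t"
  shows "zeta P c X z = ereal (t + X \<bullet> dual_res P z + c / 2 * (norm (dual_res P z))\<^sup>2)"
  using assms by (simp add: zeta_def aug_lagr_def lagr_def)

text \<open>Above: \<open>phi\<close> is finite at a maximizer \<open>p\<close>, so some Lagrangian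
  value is. Below: \<open>p\<close> supplies the minorant \<open>M \<le> t + p \<bullet> r\<close>,
  and completing the square in the residual \<open>r\<close> costs at most
  \<open>(norm (p - X))\<^sup>2 / (2 * c)\<close>.\<close>

lemma zeta_INF_finite:
  assumes P: "sdp_data P" and ne: "argmax_set (phi P) \<noteq> {}" and c: "0 < c"
  obtains m where "(INF z\<in>dual_dom P. zeta P c X z) = ereal m"
proof -
  obtain p M where M: "phi P p = ereal M" using ne by (auto simp: argmax_set_def)
  then have "(INF z. lagr P z p) < \<infinity>" by (simp add: phi_def)
  then obtain z where "lagr P z p < \<infinity>" unfolding INF_less_iff by blast
  then obtain d where d: "z \<in> dual_dom P" "dual_obj P z = ereal d"
    using dual_obj_not_MInf[OF P, of z] by (cases "dual_obj P z") (auto simp: lagr_def split: if_splits)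
  have "(INF z\<in>dual_dom P. zeta P c X z) \<le> zeta P c X z" using d by (intro INF_lower)
  also have "\<dots> < \<infinity>" using d by (simp add: zeta_eq)
  finally have up: "(INF z\<in>dual_dom P. zeta P c X z) < \<infinity>" .
  have "ereal (M - (norm (p - X))\<^sup>2 / (2 * c)) \<le> (INF z\<in>dual_dom P. zeta P c X z)"
  proof (rule INF_greatest)
    fix z assume z: "z \<in> dual_dom P"
    show "ereal (M - (norm (p - X))\<^sup>2 / (2 * c)) \<le> zeta P c X z"
    proof (cases "dual_obj P z")
      case (real t)
      let ?r = "dual_res P z"
      have "(?r, t) \<in> dual_graph P" using z real by (rule dual_graphI)
      then have "M \<le> t + p \<bullet> ?r" using M phi_ge_iff[OF P, of M p] by simp
      moreover have "0 \<le> (norm (c *\<^sub>R ?r - (p - X)))\<^sup>2 / (2 * c)" using c by simp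
      moreover have "(norm (c *\<^sub>R ?r - (p - X)))\<^sup>2 / (2 * c)
          = c / 2 * (norm ?r)\<^sup>2 - (p - X) \<bullet> ?r + (norm (p - X))\<^sup>2 / (2 * c)"
      proof -
        define r where "r = ?r"
        have "(norm (c *\<^sub>R r - (p - X)))\<^sup>2 = c\<^sup>2 * (norm r)\<^sup>2 - 2 * c * ((p - X) \<bullet> r) + (norm (p - X))\<^sup>2"
          unfolding power2_norm_eq_inner
          by (simp add: inner_commute[of r p] inner_commute[of r X] inner_commute[of X p]
              power2_eq_square algebra_simps)
        then have "(norm (c *\<^sub>R r - (p - X)))\<^sup>2
            = 2 * c * (c / 2 * (norm r)\<^sup>2 - (p - X) \<bullet> r) + (norm (p - X))\<^sup>2"
          by (simp add: power2_eq_square algebra_simps)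
        then show ?thesis unfolding r_def[symmetric] using c by (simp add: add_divide_distrib)
      qed
      ultimately have "M - (norm (p - X))\<^sup>2 / (2 * c) \<le> t + X \<bullet> ?r + c / 2 * (norm ?r)\<^sup>2"
        by (simp add: inner_diff_left)
      then show ?thesis using z real by (simp add: zeta_eq)
    next
      case PInf then show ?thesis using z by (simp add: zeta_def aug_lagr_def lagr_def)
    next
      case MInf then show ?thesis using dual_obj_not_MInf[OF P] by simp
    qed
  qed
  with up show ?thesis using that by (cases "INF z\<in>dual_dom P. zeta P c X z") auto
qed

lemma zeta_gap_bounded:
  assumes P: "sdp_data P" and m: "(INF z\<in>dual_dom P. zeta P c X z) = ereal m"
    and z: "z \<in> dual_dom P" "zeta_gap P c X z \<le> ereal g"
  obtains t where "dual_obj P z = ereal t"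
    "zeta_gap P c X z = ereal (t + X \<bullet> dual_res P z + c / 2 * (norm (dual_res P z))\<^sup>2 - m)"
proof (cases "dual_obj P z")
  case (real t)
  then show ?thesis using that z by (simp add: zeta_gap_def m zeta_eq)
next
  case PInf
  then have "zeta_gap P c X z = \<infinity>" using z by (simp add: zeta_gap_def m zeta_def aug_lagr_def lagr_def)
  then show ?thesis using z by simp
next
  case MInf
  then show ?thesis using dual_obj_not_MInf[OF P] by simp
qed

text \<open>No constraint qualification is needed for the duality behind this: the quadratic is finite
  everywhere.\<close>
lemma augmented_lagrangian_proximal_step:
  assumes P: "sdp_data P" and ne: "argmax_set (phi P) \<noteq> {}" and c: "0 < c"
  obtains x' where "proximal_step (phi P) c X x'"
    "\<And>z g. z \<in> dual_dom P \<Longrightarrow> zeta_gap P c X z \<le> ereal g \<Longrightarrow>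
       (norm (X + c *\<^sub>R dual_res P z - x'))\<^sup>2 \<le> 2 * c * g"
proof -
  obtain m where m: "(INF z\<in>dual_dom P. zeta P c X z) = ereal m" using zeta_INF_finite[OF P ne c] .
  have lower: "m \<le> t + X \<bullet> r + c / 2 * (norm r)\<^sup>2" if rt: "(r, t) \<in> dual_graph P" for r t
  proof -
    obtain z where z: "(z, t) \<in> dual_epi P" "r = dual_res P z" using rt unfolding mem_dual_graph by blast
    obtain d where d: "z \<in> dual_dom P" "dual_obj P z = ereal d" "d \<le> t" using dual_epiE[OF P z(1)] .
    have "ereal m \<le> zeta P c X z" unfolding m[symmetric] using d by (intro INF_lower)
    then show ?thesis using d z by (simp add: zeta_eq)
  qed
  have approx: "\<exists>r t. (r, t) \<in> dual_graph P \<and> t + X \<bullet> r + c / 2 * (norm r)\<^sup>2 < m + e" if "0 < e" for e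
  proof -
    have "(INF z\<in>dual_dom P. zeta P c X z) < ereal (m + e)" using that by (simp add: m)
    then obtain z where z: "z \<in> dual_dom P" "zeta P c X z < ereal (m + e)" unfolding INF_less_iff by blast
    then obtain d where d: "dual_obj P z = ereal d"
      using dual_obj_not_MInf[OF P, of z] by (cases "dual_obj P z") (auto simp: zeta_def aug_lagr_def lagr_def)
    then have "(dual_res P z, d) \<in> dual_graph P" using z by (intro dual_graphI)
    then show ?thesis using z d by (intro exI[of _ "dual_res P z"] exI[of _ d]) (simp add: zeta_eq)
  qed
  obtain x' where x': "\<And>r t. (r, t) \<in> dual_graph P \<Longrightarrow> m + (norm (x' - X))\<^sup>2 / (2 * c) \<le> t + x' \<bullet> r"
    "\<And>y s. (\<And>r t. (r, t) \<in> dual_graph P \<Longrightarrow> s \<le> t + y \<bullet> r) \<Longrightarrow>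
       s + ((norm (y - x'))\<^sup>2 - (norm (y - X))\<^sup>2) / (2 * c) \<le> m"
    using quadratic_regularization_dual[OF convex_dual_graph[OF P] c lower approx] by metis
  show ?thesis
  proof (rule that)
    \<comment> \<open>The two properties of \<open>x'\<close> bound \<open>m\<close> from below by
      \<open>s\<close> plus quadratic terms and from above by \<open>phi P x'\<close>; eliminating
      \<open>m\<close> leaves the three-point inequality.\<close>
    show "proximal_step (phi P) c X x'" unfolding proximal_step_def
    proof (intro allI impI)
      fix y s assume "ereal s \<le> phi P y"
      then have "s + ((norm (y - x'))\<^sup>2 - (norm (y - X))\<^sup>2) / (2 * c) \<le> m"
        using x'(2) phi_ge_iff[OF P] by blast
      then have "s + ((norm (y - x'))\<^sup>2 + (norm (x' - X))\<^sup>2 - (norm (y - X))\<^sup>2) / (2 * c)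
          \<le> m + (norm (x' - X))\<^sup>2 / (2 * c)"
        by (simp add: diff_divide_distrib add_divide_distrib)
      moreover have "ereal (m + (norm (x' - X))\<^sup>2 / (2 * c)) \<le> phi P x'"
        using x'(1) phi_ge_iff[OF P] by blast
      ultimately show "ereal (s + ((norm (y - x'))\<^sup>2 + (norm (x' - X))\<^sup>2 - (norm (y - X))\<^sup>2) / (2 * c)) \<le> phi P x'"
        by (meson ereal_less_eq(3) order_trans)
    qed
  next
    fix z g assume z: "z \<in> dual_dom P" "zeta_gap P c X z \<le> ereal g"
    obtain t where t: "dual_obj P z = ereal t"
      "zeta_gap P c X z = ereal (t + X \<bullet> dual_res P z + c / 2 * (norm (dual_res P z))\<^sup>2 - m)"
      using zeta_gap_bounded[OF P m z] .
    let ?r = "dual_res P z"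
    have "(?r, t) \<in> dual_graph P" using z(1) t(1) by (rule dual_graphI)
    \<comment> \<open>The lower bound by the Lagrangian at \<open>x'\<close> is played against the
      gap bound at \<open>z\<close>: their difference is a complete square in the residual.\<close>
    from x'(1)[OF this] have "2 * c * (m + (norm (x' - X))\<^sup>2 / (2 * c)) \<le> 2 * c * (t + x' \<bullet> ?r)"
      using c by simp
    then have "2 * c * m + (norm (x' - X))\<^sup>2 \<le> 2 * c * (t + x' \<bullet> ?r)"
      using c by (simp add: distrib_left)
    moreover have "2 * c * (t + X \<bullet> ?r + c / 2 * (norm ?r)\<^sup>2 - m) \<le> 2 * c * g"
      using z(2) t c by simp
    moreover have "(norm (X + c *\<^sub>R ?r - x'))\<^sup>2
        = 2 * c * (X \<bullet> ?r + c / 2 * (norm ?r)\<^sup>2 - x' \<bullet> ?r) + (norm (x' - X))\<^sup>2"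
    proof -
      define r where "r = ?r"
      show ?thesis unfolding r_def[symmetric] power2_norm_eq_inner
        by (simp add: inner_commute[of r X] inner_commute[of r x'] inner_commute[of X x'] algebra_simps)
    qed
    ultimately show "(norm (X + c *\<^sub>R ?r - x'))\<^sup>2 \<le> 2 * c * g" by (simp add: algebra_simps)
  qed
qed

text \<open>At feasible points the penalty vanishes and \<open>zeta\<close> agrees with the dual
  objective, so its infimum is at most \<open>dual_value P\<close>. At \<open>z\<close> the surplus
  of \<open>zeta\<close> over the dual objective is
  \<open>((norm Y)\<^sup>2 - (norm X)\<^sup>2) / (2 * c)\<close>.\<close>

lemma augmented_lagrangian_dual_gap:
  assumes P: "sdp_data P" and ne: "argmax_set (phi P) \<noteq> {}" and c: "0 < c"
    and z: "z \<in> dual_dom P" "zeta_gap P c X z \<le> ereal g" and Y: "Y = X + c *\<^sub>R dual_res P z"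
  shows "dual_obj P z - dual_value P
    \<le> zeta_gap P c X z + ereal (1 / (2 * c) * ((norm X)\<^sup>2 - (norm Y)\<^sup>2))"
proof -
  obtain m where m: "(INF z\<in>dual_dom P. zeta P c X z) = ereal m" using zeta_INF_finite[OF P ne c] .
  obtain t where t: "dual_obj P z = ereal t"
    "zeta_gap P c X z = ereal (t + X \<bullet> dual_res P z + c / 2 * (norm (dual_res P z))\<^sup>2 - m)"
    using zeta_gap_bounded[OF P m z] .
  have "ereal m \<le> dual_value P" unfolding dual_value_def
  proof (rule INF_greatest)
    fix z' assume z': "z' \<in> dual_feasible P"
    then have "ereal m \<le> zeta P c X z'"
      unfolding m[symmetric] by (intro INF_lower) (simp add: dual_feasible_def)
    also have "\<dots> = dual_obj P z'"
      using z' by (simp add: zeta_def aug_lagr_def lagr_def dual_feasible_def flip: zero_ereal_def)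
    finally show "ereal m \<le> dual_obj P z'" .
  qed
  \<comment> \<open>If (D) is infeasible, \<open>dual_value P\<close> is \<open>\<infinity>\<close>
    and the left side is \<open>-\<infinity>\<close>.\<close>
  then have "dual_obj P z - dual_value P \<le> ereal (t - m)"
    unfolding t(1) by (cases "dual_value P") auto
  moreover have "1 / (2 * c) * ((norm X)\<^sup>2 - (norm Y)\<^sup>2)
      = - (X \<bullet> dual_res P z + c / 2 * (norm (dual_res P z))\<^sup>2)"
  proof -
    define r where "r = dual_res P z"
    have "(norm X)\<^sup>2 - (norm Y)\<^sup>2 = - 2 * c * (X \<bullet> r + c / 2 * (norm r)\<^sup>2)"
      unfolding Y r_def[symmetric] power2_norm_eq_inner
      by (simp add: inner_commute[of r X] algebra_simps)
    then show ?thesis using c by (simp add: r_def)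
  qed
  ultimately show ?thesis unfolding t(2) by simp
qed

subsection \<open>Asymptotically optimal dual sequences\<close>

text \<open>At the optimal level the solutions are cut out by a closed set and a continuous
  equation, both stable under limits.\<close>

lemma dual_solutions_eq_sublevel:
  assumes P: "sdp_data P" and "zs \<in> dual_solutions P"
  obtains v where "dual_obj P zs = ereal v" "dual_value P = ereal v"
    "dual_solutions P = {z. (z, v) \<in> dual_epi P \<and> dual_res P z = 0}"
proof -
  obtain v where v: "dual_obj P zs = ereal v"
    using assms dual_obj_not_MInf[OF P, of zs] by (cases "dual_obj P zs") (auto simp: dual_solutions_def)
  have zs: "zs \<in> dual_feasible P" and opt: "\<And>z. z \<in> dual_feasible P \<Longrightarrow> ereal v \<le> dual_obj P z"
    using assms(2) by (auto simp: dual_solutions_def v)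
  have "dual_value P = ereal v"
    unfolding dual_value_def by (rule antisym[OF INF_lower2[OF zs] INF_greatest]) (simp_all add: v opt)
  moreover have "dual_solutions P = {z. (z, v) \<in> dual_epi P \<and> dual_res P z = 0}"
  proof (intro equalityI subsetI)
    fix z assume "z \<in> dual_solutions P"
    then have "z \<in> dual_feasible P" "dual_obj P z \<le> dual_obj P zs"
      using zs by (simp_all add: dual_solutions_def)
    then show "z \<in> {z. (z, v) \<in> dual_epi P \<and> dual_res P z = 0}"
      by (simp add: v dual_epi_def dual_feasible_def)
  next
    fix z assume z: "z \<in> {z. (z, v) \<in> dual_epi P \<and> dual_res P z = 0}"
    then have "dual_obj P z \<le> ereal v" by (simp add: dual_epi_def)
    moreover from this have "dual_obj P z \<noteq> \<infinity>" by auto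
    ultimately show "z \<in> dual_solutions P"
      using z opt by (auto simp: dual_solutions_def dual_epi_def dual_feasible_def intro: order_trans)
  qed
  ultimately show ?thesis using that v by blast
qed

text \<open>Closedness of \<open>dual_epi P\<close> acts as lower semicontinuity of the dual
  objective on \<open>dual_dom P\<close>.\<close>

lemma dual_accumulation_point:
  assumes P: "sdp_data P" and sol: "dual_solutions P = {z. (z, v) \<in> dual_epi P \<and> dual_res P z = 0}"
    and u: "\<And>n. (u n, v + \<delta> n) \<in> dual_epi P" "\<delta> \<longlonglongrightarrow> 0" "(\<lambda>n. dual_res P (u n)) \<longlonglongrightarrow> 0"
    and l: "u \<longlonglongrightarrow> l"
  shows "l \<in> dual_solutions P"
proof -
  have "(\<lambda>n. (u n, v + \<delta> n)) \<longlonglongrightarrow> (l, v + 0)" by (intro tendsto_intros l u(2))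
  from closed_sequentially[OF closed_dual_epi[OF P] u(1) this] have "(l, v) \<in> dual_epi P" by simp
  moreover have "(\<lambda>n. dual_res P (u n)) \<longlonglongrightarrow> dual_res P l"
    by (rule continuous_on_tendsto_compose[OF continuous_on_dual_res[OF P, of UNIV] l]) simp_all
  ultimately show ?thesis using LIMSEQ_unique[OF u(3)] by (simp add: sol)
qed

text \<open>Iterates outside a large ball around a solution are pulled back to its sphere along segments,
  which would give an optimal accumulation point on the sphere.\<close>
lemma dual_sequence_bounded:
  assumes P: "sdp_data P" and sol: "dual_solutions P = {z. (z, v) \<in> dual_epi P \<and> dual_res P z = 0}"
    and ne: "dual_solutions P \<noteq> {}" and bd: "bounded (dual_solutions P)"
    and u: "\<And>n. (u n, v + \<delta> n) \<in> dual_epi P" "\<delta> \<longlonglongrightarrow> 0" "(\<lambda>n. dual_res P (u n)) \<longlonglongrightarrow> 0"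
  shows "bounded (range u)"
proof -
  obtain zs where zs: "zs \<in> dual_solutions P" using ne by blast
  obtain B where B: "\<And>z. z \<in> dual_solutions P \<Longrightarrow> dist zs z \<le> B"
    using bd unfolding bounded_any_center[where a = zs] by blast
  define R where "R = \<bar>B\<bar> + 1"
  have R: "0 < R" "B < R" by (auto simp: R_def)
  have "\<exists>N. \<forall>n\<ge>N. dist zs (u n) \<le> R"
  proof (rule ccontr)
    assume "\<not> ?thesis"
    then have "\<forall>N. \<exists>n\<ge>N. R < dist zs (u n)" by (simp add: not_le)
    then obtain \<sigma> where \<sigma>: "\<And>N. N \<le> \<sigma> N" "\<And>N. R < dist zs (u (\<sigma> N))" by metis
    \<comment> \<open>The chosen indices need not be increasing; \<open>N \<le> \<sigma> N\<close>
      is enough to carry limits over.\<close>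
    have lim\<sigma>: "filterlim \<sigma> sequentially sequentially"
      by (rule filterlim_at_top_mono[OF filterlim_ident]) (simp add: \<sigma>(1))
    \<comment> \<open>This weight puts \<open>p N\<close> exactly on the sphere. Being at most 1, it
      can only shrink the excess objective and the residual, so the pulled-back points are still
      asymptotically optimal.\<close>
    define t where "t N = R / dist zs (u (\<sigma> N))" for N
    have t: "0 \<le> t N" "t N \<le> 1" for N
      using R(1) \<sigma>(2)[of N] by (auto simp: t_def divide_le_eq_1)
    define p where "p N = (1 - t N) *\<^sub>R zs + t N *\<^sub>R u (\<sigma> N)" for N
    have "dist zs (p N) = R" for N
    proof -
      have "zs - p N = t N *\<^sub>R (zs - u (\<sigma> N))" by (simp add: p_def algebra_simps)
      then have "dist zs (p N) = t N * dist zs (u (\<sigma> N))" using t by (simp add: dist_norm)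
      moreover have "dist zs (u (\<sigma> N)) \<noteq> 0" using R(1) \<sigma>(2)[of N] by linarith
      ultimately show ?thesis by (simp add: t_def)
    qed
    then have pR: "p N \<in> sphere zs R" for N by simp
    have pe: "(p N, v + t N * \<delta> (\<sigma> N)) \<in> dual_epi P" for N
    proof -
      have "(1 - t N) * v + t N * (v + \<delta> (\<sigma> N)) = v + t N * \<delta> (\<sigma> N)" by (simp add: algebra_simps)
      then show ?thesis
        using dual_epi_convex_comb[OF P _ u(1) t, of zs v N "\<sigma> N"] zs by (simp add: sol p_def)
    qed
    have d0: "(\<lambda>N. \<delta> (\<sigma> N)) \<longlonglongrightarrow> 0" by (rule filterlim_compose[OF u(2) lim\<sigma>])
    have d: "(\<lambda>N. t N * \<delta> (\<sigma> N)) \<longlonglongrightarrow> 0"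
      by (rule Lim_null_comparison[OF always_eventually tendsto_norm_zero[OF d0]])
        (use t in \<open>simp add: abs_mult mult_left_le_one_le\<close>)
    have res: "dual_res P (p N) = t N *\<^sub>R dual_res P (u (\<sigma> N))" for N
      using zs by (simp add: p_def dual_res_convex_comb[OF P] sol)
    have r0: "(\<lambda>N. dual_res P (u (\<sigma> N))) \<longlonglongrightarrow> 0" by (rule filterlim_compose[OF u(3) lim\<sigma>])
    have r: "(\<lambda>N. dual_res P (p N)) \<longlonglongrightarrow> 0"
      by (rule Lim_null_comparison[OF always_eventually tendsto_norm_zero[OF r0]])
        (use t in \<open>simp add: res mult_left_le_one_le\<close>)
    obtain l \<rho> where l: "l \<in> sphere zs R" "strict_mono \<rho>" "(p \<circ> \<rho>) \<longlonglongrightarrow> l"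
      using compact_sphere[of zs R] pR unfolding compact_def by metis
    have "l \<in> dual_solutions P"
      by (rule dual_accumulation_point[OF P sol _ _ _ l(3), of "(\<lambda>N. t N * \<delta> (\<sigma> N)) \<circ> \<rho>"])
        (use pe LIMSEQ_subseq_LIMSEQ[OF d l(2)] LIMSEQ_subseq_LIMSEQ[OF r l(2)] in \<open>auto simp: o_def\<close>)
    from B[OF this] l(1) R(2) show False by simp
  qed
  then obtain N where N: "\<And>n. N \<le> n \<Longrightarrow> dist zs (u n) \<le> R" by blast
  have "u n \<in> u ` {..<N} \<union> cball zs R" for n using N[of n] by (cases "n < N") auto
  then have "range u \<subseteq> u ` {..<N} \<union> cball zs R" by blast
  then show ?thesis by (rule bounded_subset[rotated]) (simp add: finite_imp_bounded)
qed

text \<open>Otherwise boundedness yields an accumulation point at positive distance from the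
  solutions, although every accumulation point is a solution.\<close>

lemma dual_sequence_infdist:
  assumes P: "sdp_data P" and sol: "dual_solutions P = {z. (z, v) \<in> dual_epi P \<and> dual_res P z = 0}"
    and ne: "dual_solutions P \<noteq> {}" and bd: "bounded (dual_solutions P)"
    and u: "\<And>n. (u n, v + \<delta> n) \<in> dual_epi P" "\<delta> \<longlonglongrightarrow> 0" "(\<lambda>n. dual_res P (u n)) \<longlonglongrightarrow> 0"
  shows "(\<lambda>n. infdist (u n) (dual_solutions P)) \<longlonglongrightarrow> 0"
proof (rule ccontr)
  assume "\<not> ?thesis"
  then obtain e where e: "0 < e" "\<And>N. \<exists>n\<ge>N. e \<le> infdist (u n) (dual_solutions P)"
    by (auto simp: LIMSEQ_def infdist_nonneg not_less)
  then obtain \<sigma> where \<sigma>: "\<And>N. N \<le> \<sigma> N" "\<And>N. e \<le> infdist (u (\<sigma> N)) (dual_solutions P)" by metis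
  have lim\<sigma>: "filterlim \<sigma> sequentially sequentially"
    by (rule filterlim_at_top_mono[OF filterlim_ident]) (simp add: \<sigma>(1))
  have "bounded (range (u \<circ> \<sigma>))"
    by (rule bounded_subset[OF dual_sequence_bounded[OF assms]]) auto
  then obtain l \<rho> where l: "strict_mono \<rho>" "(u \<circ> \<sigma> \<circ> \<rho>) \<longlonglongrightarrow> l"
    using bounded_imp_convergent_subsequence by blast
  have "filterlim (\<lambda>n. \<sigma> (\<rho> n)) sequentially sequentially"
    by (rule filterlim_compose[OF lim\<sigma> filterlim_subseq[OF l(1)]])
  from filterlim_compose[OF u(2) this] filterlim_compose[OF u(3) this]
  have "l \<in> dual_solutions P"
    by (intro dual_accumulation_point[OF P sol _ _ _ l(2), of "\<delta> \<circ> (\<sigma> \<circ> \<rho>)"]) (simp_all add: u(1) o_def)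
  then have "infdist l (dual_solutions P) = 0" by simp
  moreover have "(\<lambda>n. infdist ((u \<circ> \<sigma> \<circ> \<rho>) n) (dual_solutions P)) \<longlonglongrightarrow> infdist l (dual_solutions P)"
    by (intro tendsto_infdist l)
  then have "e \<le> infdist l (dual_solutions P)"
    by (rule LIMSEQ_le_const) (simp add: \<sigma>(2))
  ultimately show False using e(1) by simp
qed

subsection \<open>The Lagrangian subdifferential\<close>

text \<open>In place of a sum rule, the subgradient inequality is taken on the segment from
  \<open>z\<close> to \<open>y\<close>, divided by \<open>s\<close>, and \<open>s\<close> tends to
  0. This linearizes the squared residual, and its slope \<open>c *\<^sub>R r\<close> shifts the
  multiplier \<open>X\<close> to \<open>X + c *\<^sub>R r\<close>. The component \<open>- r\<close>
  reflects that \<open>lagr\<close> is affine in the multiplier with slope \<open>r\<close>.\<close>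

lemma subdiff_zeta_imp_T_l:
  assumes P: "sdp_data P" and c: "0 < c" and u: "u \<in> subdiff (zeta P c X) z"
  shows "(u, - dual_res P z) \<in> T_l P (z, X + c *\<^sub>R dual_res P z)"
proof -
  have fin: "\<bar>zeta P c X z\<bar> \<noteq> \<infinity>"
    and sub: "\<And>y. zeta P c X z + ereal (u \<bullet> (y - z)) \<le> zeta P c X y"
    using u by (auto simp: subdiff_def)
  obtain d where z: "z \<in> dual_dom P" and d: "dual_obj P z = ereal d"
    using fin dual_obj_not_MInf[OF P, of z]
    by (cases "z \<in> dual_dom P"; cases "dual_obj P z") (auto simp: zeta_def aug_lagr_def lagr_def)
  define r where "r = dual_res P z"
  define Y where "Y = X + c *\<^sub>R r"
  have l: "lagr P z Z = ereal (d + Z \<bullet> r)" for Z using z d by (simp add: lagr_def r_def)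
  have "lagr P z Y + ereal (u \<bullet> (y - z)) \<le> lagr P y Y" for y
  proof (cases "y \<in> dual_dom P \<and> dual_obj P y \<noteq> \<infinity>")
    case True
    then obtain d' where d': "dual_obj P y = ereal d'"
      using dual_obj_not_MInf[OF P, of y] by (cases "dual_obj P y") auto
    define r' where "r' = dual_res P y"
    have "0 \<le> (d' - d + Y \<bullet> (r' - r) - u \<bullet> (y - z)) + s * (c / 2 * (norm (r' - r))\<^sup>2)"
      if s: "0 < s" "s \<le> 1" for s
    proof -
      let ?y = "(1 - s) *\<^sub>R z + s *\<^sub>R y"
      have "(?y, (1 - s) * d + s * d') \<in> dual_epi P"
        using s z d d' True by (intro dual_epi_convex_comb[OF P]) (auto simp: dual_epi_def)
      then obtain e where e: "?y \<in> dual_dom P" "dual_obj P ?y = ereal e" "e \<le> (1 - s) * d + s * d'"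
        by (rule dual_epiE[OF P])
      have "?y - z = s *\<^sub>R (y - z)" by (simp add: algebra_simps)
      then have "d + X \<bullet> r + c / 2 * (norm r)\<^sup>2 + s * (u \<bullet> (y - z))
          \<le> e + X \<bullet> ((1 - s) *\<^sub>R r + s *\<^sub>R r') + c / 2 * (norm ((1 - s) *\<^sub>R r + s *\<^sub>R r'))\<^sup>2"
        using sub[of ?y] zeta_eq[OF z d, of c X] zeta_eq[OF e(1,2), of c X]
        by (simp add: dual_res_convex_comb[OF P] r_def r'_def)
      also have "\<dots> \<le> (1 - s) * d + s * d' + X \<bullet> ((1 - s) *\<^sub>R r + s *\<^sub>R r')
          + c / 2 * (norm ((1 - s) *\<^sub>R r + s *\<^sub>R r'))\<^sup>2"
        using e(3) by simp
      finally have le: "d + X \<bullet> r + c / 2 * (norm r)\<^sup>2 + s * (u \<bullet> (y - z)) \<le>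
        (1 - s) * d + s * d' + X \<bullet> ((1 - s) *\<^sub>R r + s *\<^sub>R r') + c / 2 * (norm ((1 - s) *\<^sub>R r + s *\<^sub>R r'))\<^sup>2" .
      define w where "w = r' - r"
      have w: "(1 - s) *\<^sub>R r + s *\<^sub>R r' = r + s *\<^sub>R w" by (simp add: w_def algebra_simps)
      have "0 \<le> s * ((d' - d + Y \<bullet> (r' - r) - u \<bullet> (y - z)) + s * (c / 2 * (norm (r' - r))\<^sup>2))"
        using le unfolding Y_def w w_def[symmetric] power2_norm_eq_inner
        by (simp add: inner_commute[of w r] algebra_simps)
      then show ?thesis using s by (simp add: zero_le_mult_iff)
    qed
    from nonneg_intercept[OF this] show ?thesis
      using True d' by (simp add: l) (simp add: lagr_def inner_diff_right flip: r'_def)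
  next
    case False then show ?thesis by (auto simp: lagr_def)
  qed
  moreover have "lagr P z Z \<le> lagr P z Y + ereal (r \<bullet> (Z - Y))" for Z
    by (simp add: l inner_commute[of r] inner_diff_left)
  ultimately show ?thesis
    unfolding T_l_def saddle_subdiff_def subdiff_def r_def[symmetric] Y_def[symmetric]
    by (simp add: l)
qed

text \<open>A zero of \<open>T_l\<close> is a saddle point: \<open>X\<close> maximizes
  \<open>lagr P z\<close>, so \<open>psi P z\<close> is the saddle value, and \<open>psi P y\<close>
  is at least \<open>lagr P y X\<close>, which is no smaller.\<close>

lemma zeros_T_l_subset:
  fixes P :: "('n::finite, 'y::euclidean_space, 'w::euclidean_space) sdp"
  assumes P: "sdp_data P" and p: "(z, X) \<in> mv_inverse (T_l P) 0"
  shows "z \<in> dual_solutions P"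
proof -
  have fin: "\<bar>lagr P z X\<bar> \<noteq> \<infinity>" and le: "\<And>y. lagr P z X \<le> lagr P y X" "\<And>Y. lagr P z Y \<le> lagr P z X"
  proof -
    have 0: "(0 :: ('y \<times> 'w \<times> 'n symmat) \<times> 'n symmat) = (0, 0)" by (rule zero_prod_def)
    note H = p[unfolded mv_inverse_def 0 T_l_def saddle_subdiff_def subdiff_def mem_Collect_eq prod.case
        minus_zero inner_zero_left zero_ereal_def[symmetric] add_0_right]
    show "\<bar>lagr P z X\<bar> \<noteq> \<infinity>" using H by simp
    show "lagr P z X \<le> lagr P y X" for y using H by blast
    show "lagr P z Y \<le> lagr P z X" for Y using H by blast
  qed
  have "psi P z = lagr P z X"
    unfolding psi_def by (rule antisym[OF SUP_least SUP_upper]) (simp_all add: le)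
  moreover have "lagr P z X \<le> psi P y" for y
    unfolding psi_def by (rule SUP_upper2[where i = X]) (simp_all add: le(1))
  ultimately have "0 \<in> subdiff (psi P) z"
    using fin unfolding subdiff_def mem_Collect_eq inner_zero_left zero_ereal_def[symmetric] add_0_right
    by metis
  then have "z \<in> mv_inverse (T_psi P) 0" unfolding mv_inverse_def T_psi_def by simp
  then show ?thesis by (simp add: mv_inverse_T_psi[OF P])
qed

text \<open>Transfers to the extended-real distance the estimates made with the real-valued
  \<open>infdist\<close>.\<close>

lemma set_dist_eq_infdist: "S \<noteq> {} \<Longrightarrow> set_dist x S = ereal (infdist x S)"
proof (rule antisym)
  assume ne: "S \<noteq> {}"
  show "ereal (infdist x S) \<le> set_dist x S"
    unfolding set_dist_def by (intro INF_greatest) (simp add: infdist_le)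
  show "set_dist x S \<le> ereal (infdist x S)"
  proof (rule ereal_le_epsilon2)
    fix e :: real assume "0 < e"
    then obtain y where y: "y \<in> S" "dist x y < infdist x S + e"
      using infdist_notempty[OF ne] cINF_less_iff[OF ne, of "dist x" "infdist x S + e"] by auto
    have "set_dist x S \<le> ereal (dist x y)" unfolding set_dist_def using y(1) by (rule INF_lower)
    also have "\<dots> \<le> ereal (infdist x S) + ereal e" using y(2) by simp
    finally show "set_dist x S \<le> ereal (infdist x S) + ereal e" .
  qed
qed

subsection \<open>Limits of the rate constants\<close>

lemma over_cinf_mult: "over_cinf r cinf = r * over_cinf 1 cinf"
  by (simp add: over_cinf_def)

text \<open>With \<open>a = \<kappa> * over_cinf 1 cinf\<close> the limit rate is
  \<open>a / sqrt (a\<^sup>2 + 1)\<close>, so later arguments treat finite and infinite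
  \<open>cinf\<close> alike.\<close>

lemma penalty_inverse_limit:
  assumes "\<And>k. 0 < c k" "mono c" "(\<lambda>k. ereal (c k)) \<longlonglongrightarrow> cinf"
  shows "(\<lambda>k. inverse (c k)) \<longlonglongrightarrow> over_cinf 1 cinf"
    and "theta_inf \<kappa> cinf = \<kappa> * over_cinf 1 cinf / sqrt ((\<kappa> * over_cinf 1 cinf)\<^sup>2 + 1)"
proof -
  have c0: "ereal (c 0) \<le> cinf"
    by (rule LIMSEQ_le_const[OF assms(3)]) (use assms(2) in \<open>auto simp: mono_def\<close>)
  have "(\<lambda>k. inverse (c k)) \<longlonglongrightarrow> over_cinf 1 cinf \<and>
    theta_inf \<kappa> cinf = \<kappa> * over_cinf 1 cinf / sqrt ((\<kappa> * over_cinf 1 cinf)\<^sup>2 + 1)"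
  proof (cases cinf)
    case (real r)
    then have r: "0 < r" using c0 assms(1)[of 0] by simp
    have "c \<longlonglongrightarrow> r" using assms(3) by (simp add: real)
    then have "(\<lambda>k. inverse (c k)) \<longlonglongrightarrow> inverse r" using r by (intro tendsto_inverse) auto
    moreover have "sqrt ((\<kappa> / r)\<^sup>2 + 1) = sqrt (\<kappa>\<^sup>2 + r\<^sup>2) / r"
    proof -
      have "(\<kappa> / r)\<^sup>2 + 1 = (\<kappa>\<^sup>2 + r\<^sup>2) / r\<^sup>2" using r by (simp add: field_simps)
      then show ?thesis using r by (simp add: real_sqrt_divide)
    qed
    ultimately show ?thesis using r by (simp add: over_cinf_def theta_inf_def real inverse_eq_divide)
  next
    case PInf
    then have "filterlim c at_top sequentially"
      using assms(3) by (simp add: tendsto_PInfty_eq_at_top)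
    then have "(\<lambda>k. inverse (c k)) \<longlonglongrightarrow> 0" by (rule tendsto_inverse_0_at_top)
    then show ?thesis by (simp add: over_cinf_def theta_inf_def PInf)
  next
    case MInf then show ?thesis using c0 by simp
  qed
  then show "(\<lambda>k. inverse (c k)) \<longlonglongrightarrow> over_cinf 1 cinf"
    "theta_inf \<kappa> cinf = \<kappa> * over_cinf 1 cinf / sqrt ((\<kappa> * over_cinf 1 cinf)\<^sup>2 + 1)" by auto
qed

lemma theta_limit:
  assumes c: "\<And>k. 0 < c k" "mono c" "(\<lambda>k. ereal (c k)) \<longlonglongrightarrow> cinf" and eta: "\<eta> \<longlonglongrightarrow> 0"
  shows "theta \<kappa> c \<eta> \<longlonglongrightarrow> theta_inf \<kappa> cinf"
proof -
  let ?i = "over_cinf 1 cinf"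
  have "\<kappa> / sqrt (\<kappa>\<^sup>2 + (c k)\<^sup>2) = \<kappa> * inverse (c k) / sqrt ((\<kappa> * inverse (c k))\<^sup>2 + 1)" for k
  proof -
    have "(\<kappa> * inverse (c k))\<^sup>2 + 1 = (\<kappa>\<^sup>2 + (c k)\<^sup>2) / (c k)\<^sup>2"
      using c(1)[of k] by (simp add: field_simps)
    then have "sqrt ((\<kappa> * inverse (c k))\<^sup>2 + 1) = sqrt (\<kappa>\<^sup>2 + (c k)\<^sup>2) / c k"
      using c(1)[of k] by (simp add: real_sqrt_divide)
    then show ?thesis using c(1)[of k] by (simp add: field_simps)
  qed
  then have eq: "theta \<kappa> c \<eta> k = (\<kappa> * inverse (c k) / sqrt ((\<kappa> * inverse (c k))\<^sup>2 + 1) + 2 * \<eta> k)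
      * inverse (1 - \<eta> k)" for k by (simp add: theta_def)
  have "theta \<kappa> c \<eta> \<longlonglongrightarrow> (\<kappa> * ?i / sqrt ((\<kappa> * ?i)\<^sup>2 + 1) + 2 * 0) * inverse (1 - 0)"
    unfolding eq by (intro tendsto_intros eta penalty_inverse_limit(1)[OF c])
      (auto simp: add_nonneg_eq_0_iff)
  then show ?thesis by (simp add: penalty_inverse_limit(2)[OF c])
qed

lemma theta_inf_less_1: "0 < \<kappa> \<Longrightarrow> (\<And>k. 0 < c k) \<Longrightarrow> mono c \<Longrightarrow> (\<lambda>k. ereal (c k)) \<longlonglongrightarrow> cinf \<Longrightarrow>
    theta_inf \<kappa> cinf < 1"
proof -
  assume k: "0 < \<kappa>" and c: "\<And>k. 0 < c k" "mono c" "(\<lambda>k. ereal (c k)) \<longlonglongrightarrow> cinf"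
  let ?a = "\<kappa> * over_cinf 1 cinf"
  have "?a < sqrt (?a\<^sup>2 + 1)" by (rule real_less_rsqrt) simp
  moreover have "0 < sqrt (?a\<^sup>2 + 1)" by (simp add: add_nonneg_pos)
  ultimately show ?thesis unfolding penalty_inverse_limit(2)[OF c] by simp
qed

subsection \<open>The augmented Lagrangian method\<close>

locale inexact_alm =
  fixes P :: "('n::finite, 'y::euclidean_space, 'w::euclidean_space) sdp"
    and c :: "nat \<Rightarrow> real" and cinf :: ereal
    and z :: "nat \<Rightarrow> 'y \<times> 'w \<times> 'n symmat" and X :: "nat \<Rightarrow> 'n symmat"
    and \<epsilon> :: "nat \<Rightarrow> real"
  assumes P: "sdp_data P" and ne: "argmax_set (phi P) \<noteq> {}"
    and c: "\<And>k. 0 < c k" "mono c" "(\<lambda>k. ereal (c k)) \<longlonglongrightarrow> cinf"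
    and seq: "alm_sequence P c z X" and crit_A: "crit_A' P c z X \<epsilon>"
begin

abbreviation \<Omega> :: "'n symmat set" where
  "\<Omega> \<equiv> argmax_set (phi P)"

text \<open>One choice satisfies the error bound for all \<open>z\<close> and \<open>g\<close> at
  once, so that (A') and (B') control the distance to the same point.\<close>

definition prox :: "nat \<Rightarrow> 'n symmat" where
  "prox k = (SOME x'. proximal_step (phi P) (c k) (X k) x' \<and>
     (\<forall>z g. z \<in> dual_dom P \<longrightarrow> zeta_gap P (c k) (X k) z \<le> ereal g \<longrightarrow>
       (norm (X k + c k *\<^sub>R dual_res P z - x'))\<^sup>2 \<le> 2 * c k * g))"

lemma X_Suc: "X (Suc k) = X k + c k *\<^sub>R dual_res P (z (Suc k))"
  using seq by (simp add: alm_sequence_def)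

lemma z_dual_dom: "z (Suc k) \<in> dual_dom P"
proof -
  obtain y w S where z: "z (Suc k) = (y, w, S)" by (cases "z (Suc k)")
  have "case z (Suc k) of (y, w, S) \<Rightarrow> y \<in> Qset P \<and> S = S_update P (c k) (X k) y w"
    using seq[unfolded alm_sequence_def, THEN conjunct2, THEN spec, of k] by (rule conjunct1)
  then have "y \<in> Qset P" "S = S_update P (c k) (X k) y w" by (simp_all add: z)
  moreover have "S_update P (c k) (X k) y w \<in> psd_cone"
    unfolding S_update_def using zero_in_psd_cone by (intro closest_point_in_set closed_psd_cone) auto
  ultimately show ?thesis by (simp add: z dual_dom_def)
qed

lemma prox_step: "proximal_step (phi P) (c k) (X k) (prox k)"
  and prox_error: "zeta_gap P (c k) (X k) (z (Suc k)) \<le> ereal g \<Longrightarrow>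
    (norm (X (Suc k) - prox k))\<^sup>2 \<le> 2 * c k * g"
proof -
  have "\<exists>x'. proximal_step (phi P) (c k) (X k) x' \<and>
     (\<forall>z g. z \<in> dual_dom P \<longrightarrow> zeta_gap P (c k) (X k) z \<le> ereal g \<longrightarrow>
       (norm (X k + c k *\<^sub>R dual_res P z - x'))\<^sup>2 \<le> 2 * c k * g)"
    using augmented_lagrangian_proximal_step[OF P ne c(1)] by metis
  from someI_ex[OF this, folded prox_def]
  have *: "proximal_step (phi P) (c k) (X k) (prox k)"
    "\<And>z g. z \<in> dual_dom P \<Longrightarrow> zeta_gap P (c k) (X k) z \<le> ereal g \<Longrightarrow>
       (norm (X k + c k *\<^sub>R dual_res P z - prox k))\<^sup>2 \<le> 2 * c k * g" by blast+
  show "proximal_step (phi P) (c k) (X k) (prox k)" by (rule *)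
  show "zeta_gap P (c k) (X k) (z (Suc k)) \<le> ereal g \<Longrightarrow> (norm (X (Suc k) - prox k))\<^sup>2 \<le> 2 * c k * g"
    unfolding X_Suc by (rule *(2)[OF z_dual_dom])
qed

lemma gap_le: "zeta_gap P (c k) (X k) (z (Suc k)) \<le> ereal ((\<epsilon> k)\<^sup>2 / (2 * c k))"
  and eps: "0 \<le> \<epsilon> k" "summable \<epsilon>"
  using crit_A by (auto simp: crit_A'_def)

text \<open>The denominator \<open>2 * c k\<close> of the criterion cancels the factor in
  \<open>prox_error\<close>, so the errors are summable without any weight.\<close>

lemma prox_error_A: "norm (X (Suc k) - prox k) \<le> \<epsilon> k"
  by (rule power2_le_imp_le) (use prox_error[OF gap_le, of k] c(1)[of k] eps(1)[of k] in simp_all)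

lemma norm_dual_res: "norm (dual_res P (z (Suc k))) = inverse (c k) * norm (X (Suc k) - X k)"
  using c(1)[of k] by (simp add: X_Suc)

lemma dual_gap: "dual_obj P (z (Suc k)) - dual_value P
    \<le> zeta_gap P (c k) (X k) (z (Suc k)) + ereal (1 / (2 * c k) * ((norm (X k))\<^sup>2 - (norm (X (Suc k)))\<^sup>2))"
  by (rule augmented_lagrangian_dual_gap[OF P ne c(1) z_dual_dom gap_le X_Suc])

lemma convergence:
  obtains x where "x \<in> \<Omega>" "X \<longlonglongrightarrow> x" "prox \<longlonglongrightarrow> x"
proof (rule inexact_proximal_point_convergence[of "phi P" "c 0" c X prox \<epsilon>])
  show "closed {X. ereal s \<le> phi P X}" for s by (rule closed_phi_superlevel[OF P])
  show "c 0 \<le> c k" for k using c(2) by (simp add: mono_def)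
qed (use ne c(1) prox_step prox_error_A eps in auto)

lemma step_null: "(\<lambda>k. norm (X (Suc k) - X k)) \<longlonglongrightarrow> 0"
proof -
  obtain x where x: "X \<longlonglongrightarrow> x" using convergence by blast
  from tendsto_norm[OF tendsto_diff[OF LIMSEQ_Suc[OF x] x]] show ?thesis by simp
qed

lemma residual_null: "(\<lambda>k. inverse (c k) * norm (X (Suc k) - X k)) \<longlonglongrightarrow> 0"
  using tendsto_mult[OF penalty_inverse_limit(1)[OF c] step_null] by simp

section \<open>Boundedness and optimality of the dual iterates\<close>

lemma dual_sequence_asymptotic:
  assumes v: "dual_value P = ereal v"
  obtains \<delta> where "\<And>n. (z (Suc n), v + \<delta> n) \<in> dual_epi P" "\<delta> \<longlonglongrightarrow> 0"
    "(\<lambda>n. dual_res P (z (Suc n))) \<longlonglongrightarrow> 0"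
proof -
  \<comment> \<open>The excess over the optimal value allowed by \<open>dual_gap\<close> and (A').
    It vanishes because \<open>X\<close> converges and \<open>inverse (c n)\<close> has a finite
    limit.\<close>
  define \<delta> where "\<delta> n = (\<epsilon> n)\<^sup>2 / (2 * c n) + 1 / (2 * c n) * ((norm (X n))\<^sup>2 - (norm (X (Suc n)))\<^sup>2)" for n
  have epi: "(z (Suc n), v + \<delta> n) \<in> dual_epi P" for n
  proof -
    have "dual_obj P (z (Suc n)) - ereal v \<le> ereal (\<delta> n)"
      unfolding \<delta>_def plus_ereal.simps(1)[symmetric]
      by (rule order_trans[OF dual_gap[of n, unfolded v] add_right_mono[OF gap_le]])
    then have "dual_obj P (z (Suc n)) \<le> ereal (v + \<delta> n)"
      by (cases "dual_obj P (z (Suc n))") auto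
    then show ?thesis by (simp add: dual_epi_def z_dual_dom)
  qed
  obtain x where x: "X \<longlonglongrightarrow> x" using convergence by blast
  have "(\<lambda>n. inverse (c n) / 2 * ((\<epsilon> n)\<^sup>2 + ((norm (X n))\<^sup>2 - (norm (X (Suc n)))\<^sup>2)))
      \<longlonglongrightarrow> over_cinf 1 cinf / 2 * (0\<^sup>2 + ((norm x)\<^sup>2 - (norm x)\<^sup>2))"
    by (intro tendsto_intros penalty_inverse_limit(1)[OF c] summable_LIMSEQ_zero[OF eps(2)] x LIMSEQ_Suc[OF x]) simp
  moreover have "inverse (c n) / 2 * ((\<epsilon> n)\<^sup>2 + ((norm (X n))\<^sup>2 - (norm (X (Suc n)))\<^sup>2)) = \<delta> n" for n
    using c(1)[of n] by (simp add: \<delta>_def field_simps)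
  ultimately have null: "\<delta> \<longlonglongrightarrow> 0" by simp
  have "(\<lambda>n. norm (dual_res P (z (Suc n)))) \<longlonglongrightarrow> 0" unfolding norm_dual_res by (rule residual_null)
  then have "(\<lambda>n. dual_res P (z (Suc n))) \<longlonglongrightarrow> 0" by (simp only: tendsto_norm_zero_iff)
  then show ?thesis by (rule that[OF epi null])
qed

lemma dual_boundedness:
  assumes ne: "dual_solutions P \<noteq> {}" and bd: "bounded (dual_solutions P)"
  shows "bounded (range z)"
    and "(\<lambda>n. infdist (z (Suc n)) (dual_solutions P)) \<longlonglongrightarrow> 0"
    and "strict_mono r \<Longrightarrow> (z \<circ> r) \<longlonglongrightarrow> l \<Longrightarrow> l \<in> dual_solutions P"
proof -
  obtain zs where zs: "zs \<in> dual_solutions P" using ne by blast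
  obtain v where v: "dual_value P = ereal v"
    and sol: "dual_solutions P = {z. (z, v) \<in> dual_epi P \<and> dual_res P z = 0}"
    using dual_solutions_eq_sublevel[OF P zs] .
  obtain \<delta> where \<delta>: "\<And>n. (z (Suc n), v + \<delta> n) \<in> dual_epi P" "\<delta> \<longlonglongrightarrow> 0"
    "(\<lambda>n. dual_res P (z (Suc n))) \<longlonglongrightarrow> 0" using dual_sequence_asymptotic[OF v] by blast
  have "bounded (range (\<lambda>n. z (Suc n)))" by (rule dual_sequence_bounded[OF P sol ne bd \<delta>])
  \<comment> \<open>The start \<open>z 0\<close> is arbitrary and obeys no criterion, so it is added
    separately.\<close>
  moreover have "z n \<in> insert (z 0) (range (\<lambda>n. z (Suc n)))" for n by (cases n) auto
  then have "range z \<subseteq> insert (z 0) (range (\<lambda>n. z (Suc n)))" by blast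
  ultimately show "bounded (range z)" by (meson bounded_insert bounded_subset)
  show inf: "(\<lambda>n. infdist (z (Suc n)) (dual_solutions P)) \<longlonglongrightarrow> 0"
    by (rule dual_sequence_infdist[OF P sol ne bd \<delta>])
  have cl: "closed (dual_solutions P)"
    unfolding sol Collect_conj_eq
    by (intro closed_Int closed_Collect_eq continuous_on_dual_res[OF P] continuous_intros)
      (use continuous_closed_vimage[OF closed_dual_epi[OF P], of "\<lambda>z. (z, v)"] in \<open>simp add: vimage_def\<close>)
  assume r: "strict_mono r" and l: "(z \<circ> r) \<longlonglongrightarrow> l"
  have "(\<lambda>n. infdist (z n) (dual_solutions P)) \<longlonglongrightarrow> 0" using inf by (rule LIMSEQ_imp_Suc)
  from LIMSEQ_subseq_LIMSEQ[OF this r] have "(\<lambda>n. infdist ((z \<circ> r) n) (dual_solutions P)) \<longlonglongrightarrow> 0"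
    by (simp add: o_def)
  from LIMSEQ_unique[OF tendsto_infdist[OF l] this] show "l \<in> dual_solutions P"
    using in_closed_iff_infdist_zero[OF cl ne] by simp
qed

section \<open>Rates under the relative stopping criteria\<close>

context
  fixes \<eta> :: "nat \<Rightarrow> real"
  assumes crit_B: "crit_B' P c z X \<eta>"
begin

lemma eta: "0 \<le> \<eta> k" "\<eta> \<longlonglongrightarrow> 0"
  using crit_B summable_LIMSEQ_zero by (auto simp: crit_B'_def)

lemma gap_le_B: "zeta_gap P (c k) (X k) (z (Suc k)) \<le> ereal ((\<eta> k)\<^sup>2 / (2 * c k) * (norm (X (Suc k) - X k))\<^sup>2)"
  using crit_B by (auto simp: crit_B'_def)

lemma prox_error_B: "norm (X (Suc k) - prox k) \<le> \<eta> k * norm (X (Suc k) - X k)"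
  by (rule power2_le_imp_le)
    (use prox_error[OF gap_le_B, of k] c(1)[of k] eta(1)[of k] in \<open>simp_all add: power_mult_distrib\<close>)

lemma step_le:
  assumes "\<eta> k < 1"
  shows "norm (X (Suc k) - X k) \<le> inverse (1 - \<eta> k) * infdist (X k) \<Omega>"
  by (rule inexact_step_le_infdist[OF prox_step c(1) ne closed_argmax_phi[OF P] prox_error_B eta(1) assms])

text \<open>The sum of norms in \<open>tau'\<close> comes from factoring the difference of squares
  in \<open>dual_gap\<close>, the term with \<open>\<eta> k\<close> from the criterion. Both carry
  one step length, which \<open>step_le\<close> turns into a distance.\<close>

lemma dual_gap_le:
  assumes "\<eta> k < 1"
  shows "dual_obj P (z (Suc k)) - dual_value P \<le> ereal (tau' c \<eta> X k * infdist (X k) \<Omega>)"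
proof -
  let ?d = "norm (X (Suc k) - X k)"
  let ?w = "(\<eta> k)\<^sup>2 * ?d + norm (X (Suc k)) + norm (X k)"
  have "(norm (X k))\<^sup>2 - (norm (X (Suc k)))\<^sup>2 = (norm (X k) - norm (X (Suc k))) * (norm (X k) + norm (X (Suc k)))"
    by (simp add: power2_eq_square algebra_simps)
  also have "\<dots> \<le> ?d * (norm (X k) + norm (X (Suc k)))"
    using norm_triangle_ineq2[of "X k" "X (Suc k)"] by (intro mult_right_mono) (simp_all add: norm_minus_commute)
  finally have "(\<eta> k)\<^sup>2 * ?d\<^sup>2 + ((norm (X k))\<^sup>2 - (norm (X (Suc k)))\<^sup>2) \<le> ?w * ?d"
    by (simp add: power2_eq_square algebra_simps)
  also have "\<dots> \<le> ?w * (inverse (1 - \<eta> k) * infdist (X k) \<Omega>)"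
    by (intro mult_left_mono step_le assms) simp
  finally have "1 / (2 * c k) * ((\<eta> k)\<^sup>2 * ?d\<^sup>2 + ((norm (X k))\<^sup>2 - (norm (X (Suc k)))\<^sup>2))
      \<le> 1 / (2 * c k) * (?w * (inverse (1 - \<eta> k) * infdist (X k) \<Omega>))"
    using c(1)[of k] by (intro mult_left_mono) auto
  moreover have "1 / (2 * c k) * (w * (i * D)) = inverse (c k) * i * w / 2 * D" for w i D
    using c(1)[of k] by (simp add: field_simps)
  moreover have "(\<eta> k)\<^sup>2 / (2 * c k) * ?d\<^sup>2 = 1 / (2 * c k) * ((\<eta> k)\<^sup>2 * ?d\<^sup>2)" by simp
  ultimately have "(\<eta> k)\<^sup>2 / (2 * c k) * ?d\<^sup>2 + 1 / (2 * c k) * ((norm (X k))\<^sup>2 - (norm (X (Suc k)))\<^sup>2)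
      \<le> tau' c \<eta> X k * infdist (X k) \<Omega>"
    by (simp only: tau'_def tau_def distrib_left[of "1 / (2 * c k)"])
  then show ?thesis
    unfolding ereal_less_eq(3)[symmetric] plus_ereal.simps(1)[symmetric]
    by (rule order_trans[OF order_trans[OF dual_gap[of k] add_right_mono[OF gap_le_B]]])
qed

text \<open>Subregularity is applied at \<open>prox k\<close>, not at the iterate: there the
  proximal step supplies the explicit subgradient
  \<open>(1 / c k) *\<^sub>R (X k - prox k)\<close>.\<close>

lemma contraction:
  assumes "0 < \<kappa>" "metrically_subregular (T_phi P) x 0 \<kappa>" "prox \<longlonglongrightarrow> x"
  shows "\<forall>\<^sub>F k in sequentially. \<eta> k < 1 \<and> theta \<kappa> c \<eta> k < 1 \<and>
    infdist (X (Suc k)) \<Omega> \<le> theta \<kappa> c \<eta> k * infdist (X k) \<Omega>"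
proof -
  obtain U where U: "open U" "x \<in> U" "\<And>Y. Y \<in> U \<Longrightarrow> T_phi P Y \<noteq> {} \<Longrightarrow>
      set_dist Y \<Omega> \<le> ereal \<kappa> * set_dist 0 (T_phi P Y)"
    using assms(2) unfolding metrically_subregular_def zeros_T_phi by blast
  have "\<forall>\<^sub>F k in sequentially. \<eta> k < 1" by (rule order_tendstoD(2)[OF eta(2)]) simp
  moreover have "\<forall>\<^sub>F k in sequentially. theta \<kappa> c \<eta> k < 1"
    by (rule order_tendstoD(2)[OF theta_limit[OF c eta(2)] theta_inf_less_1[OF assms(1) c]])
  moreover have "\<forall>\<^sub>F k in sequentially. prox k \<in> U" by (rule topological_tendstoD[OF assms(3) U(1,2)])
  ultimately show ?thesis
  proof eventually_elim
    case (elim k)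
    obtain p where "p \<in> \<Omega>" using ne by blast
    from proximal_step_subgradient[OF prox_step c(1) this]
    have sub: "(1 / c k) *\<^sub>R (X k - prox k) \<in> T_phi P (prox k)" by (simp add: T_phi_def)
    have "set_dist (prox k) \<Omega> \<le> ereal \<kappa> * set_dist 0 (T_phi P (prox k))"
      using sub by (intro U(3) elim) auto
    also have "\<dots> \<le> ereal \<kappa> * ereal (dist 0 ((1 / c k) *\<^sub>R (X k - prox k)))"
      unfolding set_dist_def using assms(1) sub by (intro ereal_mult_left_mono INF_lower) auto
    finally have "infdist (prox k) \<Omega> \<le> \<kappa> * (norm (X k - prox k) / c k)"
      using c(1)[of k] by (simp add: set_dist_eq_infdist[OF ne])
    from inexact_proximal_contraction(2)[OF prox_step c(1) ne closed_argmax_phi[OF P] prox_error_B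
        eta(1) elim(1) assms(1) this] elim
    show ?case by (simp add: theta_def)
  qed
qed

lemma tau_limit: "tau c \<eta> \<longlonglongrightarrow> over_cinf 1 cinf"
proof -
  have "(\<lambda>k. inverse (c k) * inverse (1 - \<eta> k)) \<longlonglongrightarrow> over_cinf 1 cinf * inverse (1 - 0)"
    by (intro tendsto_intros penalty_inverse_limit(1)[OF c] eta) simp
  then show ?thesis by (simp add: tau_def[abs_def])
qed

lemma tau'_limit:
  assumes x: "X \<longlonglongrightarrow> x"
  shows "tau' c \<eta> X \<longlonglongrightarrow> over_cinf (norm x) cinf"
proof -
  have "tau' c \<eta> X \<longlonglongrightarrow> over_cinf 1 cinf * (0\<^sup>2 * 0 + norm x + norm x) / 2"
    unfolding tau'_def[abs_def]
    by (intro tendsto_intros tau_limit eta step_null x LIMSEQ_Suc[OF x]) simp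
  then show ?thesis by (simp add: over_cinf_mult[of "norm x"] mult.commute)
qed

lemma theta'_limit:
  assumes "\<eta>' \<longlonglongrightarrow> 0"
  shows "theta' \<kappa> c \<eta> \<eta>' \<longlonglongrightarrow> over_cinf \<kappa> cinf"
proof -
  have "theta' \<kappa> c \<eta> \<eta>' \<longlonglongrightarrow> \<kappa> * over_cinf 1 cinf * (1 + 0) * inverse (1 - 0)"
    unfolding theta'_def[abs_def]
    by (intro tendsto_intros penalty_inverse_limit(1)[OF c] eta assms) simp
  then show ?thesis by (simp add: over_cinf_mult[of \<kappa>])
qed

text \<open>In the element \<open>(u, - r)\<close> of \<open>T_l\<close> at the new iterate, (B'')
  bounds \<open>u\<close> and the multiplier update determines \<open>r\<close>, both in units of
  the step length over \<open>c k\<close>; hence the factor \<open>1 + \<eta>' k\<close>.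
  Convergence of the multipliers and \<open>dual_boundedness\<close> bring the iterates into the
  region where \<open>reg\<close> applies.\<close>

lemma dual_rate:
  assumes B: "crit_B'' P c z X \<eta>'" and x: "X \<longlonglongrightarrow> x"
    and sol: "dual_solutions P \<noteq> {}" "bounded (dual_solutions P)" and pos: "0 \<le> \<kappa>" "0 < \<delta>"
    and reg: "\<And>p. set_dist p (dual_solutions P \<times> {x}) \<le> ereal \<delta> \<Longrightarrow> T_l P p \<noteq> {} \<Longrightarrow>
      set_dist p (mv_inverse (T_l P) 0) \<le> ereal \<kappa> * set_dist 0 (T_l P p)"
  shows "\<forall>\<^sub>F k in sequentially. \<eta> k < 1 \<and>
    set_dist (z (Suc k)) (dual_solutions P) \<le> ereal (theta' \<kappa> c \<eta> \<eta>' k * infdist (X k) \<Omega>)"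
proof -
  have eta': "0 \<le> \<eta>' k" and sd: "set_dist 0 (subdiff (zeta P (c k) (X k)) (z (Suc k)))
      \<le> ereal (\<eta>' k / c k * norm (X (Suc k) - X k))" for k
    using B by (auto simp: crit_B''_def)
  have "(\<lambda>k. infdist (z (Suc k)) (dual_solutions P) + dist (X (Suc k)) x) \<longlonglongrightarrow> 0 + dist x x"
    by (intro tendsto_add dual_boundedness[OF sol] tendsto_dist LIMSEQ_Suc[OF x] tendsto_const)
  then have "\<forall>\<^sub>F k in sequentially. infdist (z (Suc k)) (dual_solutions P) + dist (X (Suc k)) x < \<delta>"
    by (rule order_tendstoD) (simp add: pos)
  moreover have "\<forall>\<^sub>F k in sequentially. \<eta> k < 1" by (rule order_tendstoD(2)[OF eta(2)]) simp
  ultimately show ?thesis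
  proof eventually_elim
    case (elim k)
    let ?p = "(z (Suc k), X (Suc k))" and ?d = "norm (X (Suc k) - X k)"
    have near: "set_dist ?p (dual_solutions P \<times> {x}) \<le> ereal \<delta>"
    proof -
      have "infdist (z (Suc k)) (dual_solutions P) < \<delta> - dist (X (Suc k)) x" using elim by simp
      then obtain y where y: "y \<in> dual_solutions P" "dist (z (Suc k)) y < \<delta> - dist (X (Suc k)) x"
        unfolding infdist_notempty[OF sol(1)]
        using cINF_less_iff[OF sol(1), of "dist (z (Suc k))"] by auto
      have "set_dist ?p (dual_solutions P \<times> {x}) \<le> ereal (dist ?p (y, x))"
        unfolding set_dist_def using y(1) by (intro INF_lower) simp
      also have "dist ?p (y, x) \<le> dist (z (Suc k)) y + dist (X (Suc k)) x"
        unfolding dist_Pair_Pair by (intro sqrt_sum_squares_le_sum) simp_all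
      also have "\<dots> \<le> \<delta>" using y(2) by simp
      finally show ?thesis by simp
    qed
    have Tl: "(u, - dual_res P (z (Suc k))) \<in> T_l P ?p"
      if "u \<in> subdiff (zeta P (c k) (X k)) (z (Suc k))" for u
      unfolding X_Suc by (rule subdiff_zeta_imp_T_l[OF P c(1) that])
    \<comment> \<open>A slack \<open>e\<close> avoids having to know that the distance to the
      subdifferential is attained.\<close>
    have dist_le: "set_dist 0 (T_l P ?p) \<le> ereal ((1 + \<eta>' k) / c k * ?d)"
    proof (rule ereal_le_epsilon2)
      fix e :: real assume e: "0 < e"
      have "set_dist 0 (subdiff (zeta P (c k) (X k)) (z (Suc k))) < ereal (\<eta>' k / c k * ?d + e)"
        by (rule le_less_trans[OF sd]) (use e in simp)
      then obtain u where u: "u \<in> subdiff (zeta P (c k) (X k)) (z (Suc k))" "norm u < \<eta>' k / c k * ?d + e"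
        unfolding set_dist_def INF_less_iff by auto
      have "set_dist 0 (T_l P ?p) \<le> ereal (dist 0 (u, - dual_res P (z (Suc k))))"
        unfolding set_dist_def using Tl[OF u(1)] by (rule INF_lower)
      also have "dist 0 (u, - dual_res P (z (Suc k))) \<le> norm u + norm (dual_res P (z (Suc k)))"
        using norm_Pair_le[of u "- dual_res P (z (Suc k))"] by simp
      also have "\<dots> \<le> (1 + \<eta>' k) / c k * ?d + e"
        using u(2) by (simp add: norm_dual_res add_divide_distrib distrib_right inverse_eq_divide)
      finally show "set_dist 0 (T_l P ?p) \<le> ereal ((1 + \<eta>' k) / c k * ?d) + ereal e" by simp
    qed
    \<comment> \<open>The empty set has \<open>set_dist\<close> equal to \<open>\<infinity>\<close>,
      so a finite distance meets the guard in \<open>reg\<close>.\<close>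
    have "T_l P ?p \<noteq> {}"
      using dist_le by (auto simp: set_dist_def top_ereal_def)
    \<comment> \<open>Dropping the multiplier component shortens distances and sends zeros of
      \<open>T_l\<close> to dual solutions.\<close>
    have "set_dist (z (Suc k)) (dual_solutions P) \<le> set_dist ?p (mv_inverse (T_l P) 0)"
      unfolding set_dist_def
    proof (rule INF_greatest)
      fix q assume "q \<in> mv_inverse (T_l P) 0"
      then have "fst q \<in> dual_solutions P" using zeros_T_l_subset[OF P, of "fst q" "snd q"] by simp
      then have "(INF y\<in>dual_solutions P. ereal (dist (z (Suc k)) y)) \<le> ereal (dist (z (Suc k)) (fst q))"
        by (rule INF_lower)
      also have "\<dots> \<le> ereal (dist ?p q)" using dist_fst_le[of ?p q] by simp
      finally show "(INF y\<in>dual_solutions P. ereal (dist (z (Suc k)) y)) \<le> ereal (dist ?p q)" .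
    qed
    also have "\<dots> \<le> ereal \<kappa> * set_dist 0 (T_l P ?p)" by (rule reg[OF near \<open>T_l P ?p \<noteq> {}\<close>])
    also have "\<dots> \<le> ereal \<kappa> * ereal ((1 + \<eta>' k) / c k * ?d)"
      using dist_le pos by (intro ereal_mult_left_mono) auto
    also have "\<dots> \<le> ereal (\<kappa> * ((1 + \<eta>' k) / c k * (inverse (1 - \<eta> k) * infdist (X k) \<Omega>)))"
      using pos eta'[of k] c(1)[of k] step_le[OF elim(2)]
      by (simp only: times_ereal.simps ereal_less_eq) (intro mult_left_mono, auto)
    also have "\<dots> = ereal (theta' \<kappa> c \<eta> \<eta>' k * infdist (X k) \<Omega>)"
      by (simp add: theta'_def divide_inverse)
    finally show ?case using elim by simp
  qed
qed

end

end

theorem theorem4p2: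
  fixes P :: "('n::finite, 'y::euclidean_space, 'w::euclidean_space) sdp"
    and c :: "nat \<Rightarrow> real" and cinf :: ereal
    and z :: "nat \<Rightarrow> 'y \<times> 'w \<times> 'n symmat" and X :: "nat \<Rightarrow> 'n symmat"
    and \<epsilon> :: "nat \<Rightarrow> real"
  assumes "sdp_data P"
    and "mv_inverse (T_phi P) 0 \<noteq> {}"
    and "\<And>k. 0 < c k" and "mono c" and "(\<lambda>k. ereal (c k)) \<longlonglongrightarrow> cinf"
    and "alm_sequence P c z X"
    and "crit_A' P c z X \<epsilon>"
  shows "(primal_solutions P \<noteq> {} \<longrightarrow> mv_inverse (T_phi P) 0 = primal_solutions P) \<and>
    bounded (range X) \<and>
    (\<exists>Xinf \<in> mv_inverse (T_phi P) 0. X \<longlonglongrightarrow> Xinf \<and>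
      (\<forall>\<kappa>\<^sub>\<phi> \<eta>. 0 < \<kappa>\<^sub>\<phi> \<and> metrically_subregular (T_phi P) Xinf 0 \<kappa>\<^sub>\<phi> \<and> crit_B' P c z X \<eta> \<longrightarrow>
        (\<exists>kbar. \<forall>k\<ge>kbar. \<eta> k < 1 \<and> theta \<kappa>\<^sub>\<phi> c \<eta> k < 1 \<and>
          set_dist (X (Suc k)) (mv_inverse (T_phi P) 0)
            \<le> ereal (theta \<kappa>\<^sub>\<phi> c \<eta> k) * set_dist (X k) (mv_inverse (T_phi P) 0) \<and>
          ereal (norm (dual_res P (z (Suc k))))
            \<le> ereal (tau c \<eta> k) * set_dist (X k) (mv_inverse (T_phi P) 0) \<and>
          dual_obj P (z (Suc k)) - dual_value P
            \<le> ereal (tau' c \<eta> X k) * set_dist (X k) (mv_inverse (T_phi P) 0)) \<and>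
        theta \<kappa>\<^sub>\<phi> c \<eta> \<longlonglongrightarrow> theta_inf \<kappa>\<^sub>\<phi> cinf \<and>
        tau c \<eta> \<longlonglongrightarrow> over_cinf 1 cinf \<and>
        tau' c \<eta> X \<longlonglongrightarrow> over_cinf (norm Xinf) cinf) \<and>
      (\<forall>\<kappa>\<^sub>\<phi> \<eta> \<eta>' \<kappa>\<^sub>l \<delta>. 0 < \<kappa>\<^sub>\<phi> \<and> metrically_subregular (T_phi P) Xinf 0 \<kappa>\<^sub>\<phi> \<and>
          crit_B' P c z X \<eta> \<and> crit_B'' P c z X \<eta>' \<and>
          mv_inverse (T_psi P) 0 \<noteq> {} \<and> bounded (mv_inverse (T_psi P) 0) \<and>
          0 \<le> \<kappa>\<^sub>l \<and> 0 < \<delta> \<and>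
          (\<forall>p. set_dist p (mv_inverse (T_psi P) 0 \<times> {Xinf}) \<le> ereal \<delta> \<and> T_l P p \<noteq> {} \<longrightarrow>
             set_dist p (mv_inverse (T_l P) 0) \<le> ereal \<kappa>\<^sub>l * set_dist 0 (T_l P p)) \<longrightarrow>
        (\<exists>ktilde. \<forall>k\<ge>ktilde. \<eta> k < 1 \<and>
          set_dist (z (Suc k)) (mv_inverse (T_psi P) 0)
            \<le> ereal (theta' \<kappa>\<^sub>l c \<eta> \<eta>' k) * set_dist (X k) (mv_inverse (T_phi P) 0)) \<and>
        theta' \<kappa>\<^sub>l c \<eta> \<eta>' \<longlonglongrightarrow> over_cinf \<kappa>\<^sub>l cinf)) \<and>
    (\<forall>k. z (Suc k) \<in> dual_dom P \<and>
      norm (dual_res P (z (Suc k))) = inverse (c k) * norm (X (Suc k) - X k) \<and>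
      dual_obj P (z (Suc k)) - dual_value P
        \<le> zeta_gap P (c k) (X k) (z (Suc k))
            + ereal (1 / (2 * c k) * ((norm (X k))\<^sup>2 - (norm (X (Suc k)))\<^sup>2))) \<and>
    (\<lambda>k. inverse (c k) * norm (X (Suc k) - X k)) \<longlonglongrightarrow> 0 \<and>
    (dual_solutions P \<noteq> {} \<and> bounded (dual_solutions P) \<longrightarrow>
      bounded (range z) \<and>
      (\<forall>zbar r. strict_mono r \<and> (z \<circ> r) \<longlonglongrightarrow> zbar \<longrightarrow> zbar \<in> dual_solutions P))"
proof -
  interpret inexact_alm P c cinf z X \<epsilon>
    by unfold_locales (use assms in \<open>auto simp: zeros_T_phi\<close>)
  \<comment> \<open>The limit of the proximal points is kept as well, since
    \<open>contraction\<close> needs them to enter the neighborhood of subregularity.\<close>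
  obtain x where x: "x \<in> \<Omega>" "X \<longlonglongrightarrow> x" "prox \<longlonglongrightarrow> x" using convergence .
  have primal: "(\<exists>kbar. \<forall>k\<ge>kbar. \<eta> k < 1 \<and> theta \<kappa> c \<eta> k < 1 \<and>
      set_dist (X (Suc k)) (mv_inverse (T_phi P) 0)
        \<le> ereal (theta \<kappa> c \<eta> k) * set_dist (X k) (mv_inverse (T_phi P) 0) \<and>
      ereal (norm (dual_res P (z (Suc k))))
        \<le> ereal (tau c \<eta> k) * set_dist (X k) (mv_inverse (T_phi P) 0) \<and>
      dual_obj P (z (Suc k)) - dual_value P
        \<le> ereal (tau' c \<eta> X k) * set_dist (X k) (mv_inverse (T_phi P) 0)) \<and>
    theta \<kappa> c \<eta> \<longlonglongrightarrow> theta_inf \<kappa> cinf \<and>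
    tau c \<eta> \<longlonglongrightarrow> over_cinf 1 cinf \<and>
    tau' c \<eta> X \<longlonglongrightarrow> over_cinf (norm x) cinf"
    if k: "0 < \<kappa>" "metrically_subregular (T_phi P) x 0 \<kappa>" and B: "crit_B' P c z X \<eta>" for \<kappa> \<eta>
  proof (intro conjI theta_limit[OF c eta(2)[OF B]] tau_limit[OF B] tau'_limit[OF B x(2)])
    obtain kbar where kbar: "\<And>k. kbar \<le> k \<Longrightarrow> \<eta> k < 1 \<and> theta \<kappa> c \<eta> k < 1 \<and>
        infdist (X (Suc k)) \<Omega> \<le> theta \<kappa> c \<eta> k * infdist (X k) \<Omega>"
      using contraction[OF B k x(3)] unfolding eventually_sequentially by blast
    have "norm (dual_res P (z (Suc k))) \<le> tau c \<eta> k * infdist (X k) \<Omega>" if "\<eta> k < 1" for k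
      using mult_left_mono[OF step_le[OF B that], of "inverse (c k)"] c(1)[of k]
      by (simp add: norm_dual_res tau_def mult.assoc)
    with kbar dual_gap_le[OF B] show "\<exists>kbar. \<forall>k\<ge>kbar. \<eta> k < 1 \<and> theta \<kappa> c \<eta> k < 1 \<and>
      set_dist (X (Suc k)) (mv_inverse (T_phi P) 0)
        \<le> ereal (theta \<kappa> c \<eta> k) * set_dist (X k) (mv_inverse (T_phi P) 0) \<and>
      ereal (norm (dual_res P (z (Suc k))))
        \<le> ereal (tau c \<eta> k) * set_dist (X k) (mv_inverse (T_phi P) 0) \<and>
      dual_obj P (z (Suc k)) - dual_value P
        \<le> ereal (tau' c \<eta> X k) * set_dist (X k) (mv_inverse (T_phi P) 0)"
      unfolding zeros_T_phi set_dist_eq_infdist[OF ne] times_ereal.simps ereal_less_eq by blast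
  qed
  have dual: "(\<exists>ktilde. \<forall>k\<ge>ktilde. \<eta> k < 1 \<and>
      set_dist (z (Suc k)) (mv_inverse (T_psi P) 0)
        \<le> ereal (theta' \<kappa> c \<eta> \<eta>' k) * set_dist (X k) (mv_inverse (T_phi P) 0)) \<and>
    theta' \<kappa> c \<eta> \<eta>' \<longlonglongrightarrow> over_cinf \<kappa> cinf"
    if B: "crit_B' P c z X \<eta>" and B': "crit_B'' P c z X \<eta>'"
      and sol: "mv_inverse (T_psi P) 0 \<noteq> {}" "bounded (mv_inverse (T_psi P) 0)"
      and pos: "0 \<le> \<kappa>" "0 < \<delta>"
      and reg: "\<forall>p. set_dist p (mv_inverse (T_psi P) 0 \<times> {x}) \<le> ereal \<delta> \<and> T_l P p \<noteq> {} \<longrightarrow>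
        set_dist p (mv_inverse (T_l P) 0) \<le> ereal \<kappa> * set_dist 0 (T_l P p)"
    for \<eta> \<eta>' \<kappa> \<delta>
  proof (intro conjI theta'_limit[OF B])
    show "\<eta>' \<longlonglongrightarrow> 0" using B' by (simp add: crit_B''_def)
    show "\<exists>ktilde. \<forall>k\<ge>ktilde. \<eta> k < 1 \<and>
      set_dist (z (Suc k)) (mv_inverse (T_psi P) 0)
        \<le> ereal (theta' \<kappa> c \<eta> \<eta>' k) * set_dist (X k) (mv_inverse (T_phi P) 0)"
      using dual_rate[OF B B' x(2) sol[unfolded mv_inverse_T_psi[OF P]] pos] reg
      unfolding mv_inverse_T_psi[OF P] zeros_T_phi set_dist_eq_infdist[OF ne] times_ereal.simps
        eventually_sequentially by blast
  qed
  have xm: "x \<in> mv_inverse (T_phi P) 0" using x(1) by (simp only: zeros_T_phi)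
  show ?thesis
  proof (intro conjI bexI[OF _ xm])
    show "primal_solutions P \<noteq> {} \<longrightarrow> mv_inverse (T_phi P) 0 = primal_solutions P"
      using mv_inverse_T_phi[OF P] by blast
    show "bounded (range X)" using x(2) by (rule convergent_imp_bounded)
    show "X \<longlonglongrightarrow> x" by (rule x)
    show "\<forall>k. z (Suc k) \<in> dual_dom P \<and>
      norm (dual_res P (z (Suc k))) = inverse (c k) * norm (X (Suc k) - X k) \<and>
      dual_obj P (z (Suc k)) - dual_value P
        \<le> zeta_gap P (c k) (X k) (z (Suc k))
            + ereal (1 / (2 * c k) * ((norm (X k))\<^sup>2 - (norm (X (Suc k)))\<^sup>2))"
      by (intro allI conjI z_dual_dom norm_dual_res dual_gap)
    show "(\<lambda>k. inverse (c k) * norm (X (Suc k) - X k)) \<longlonglongrightarrow> 0" by (rule residual_null)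
    show "dual_solutions P \<noteq> {} \<and> bounded (dual_solutions P) \<longrightarrow>
      bounded (range z) \<and>
      (\<forall>zbar r. strict_mono r \<and> (z \<circ> r) \<longlonglongrightarrow> zbar \<longrightarrow> zbar \<in> dual_solutions P)"
      using dual_boundedness by blast
  qed ((intro allI impI, elim conjE, rule primal, assumption+),
      (intro allI impI, elim conjE, rule dual, assumption+))
qed

end
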